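(* Let $k\ge 2$ and let $\Gamma$ be a $k$-cube group with adjacency structure $E_1,\ldots,E_k$. Then $\Gamma$ induces a row-finite rank-$k$ graph $\mathcal{G}(\Gamma)$ with no sources; that is, the category $\mathcal{G}(\Gamma)$ built from the adjacency matrices $M_1,\ldots,M_k$ of $\Gamma$ (see context), together with its degree map $d:\mathcal{G}(\Gamma)\to\mathbb{N}^k$, is a rank-$k$ graph which is row-finite and has no sources.
   Context: **$k$-cube groups.** Let $k\ge 2$ and let $E_1,\ldots,E_k$ be finite sets with $|E_i|=2m_i$, $m_i\ge 2$, each endowed with a fixed-point-free involution $a\mapsto a^{-1}$. For $i\ne j$ put $F(i,j)=E_i\times E_j\times E_i\times E_j$, let $R\subseteq\bigsqcup_{i\neq j}F(i,j)$, $R(i,j):=R\cap F(i,j)$, and $\Gamma=\langle E_1\sqcup\cdots\sqcup E_k \mid aba'b'=1 \text{ for } (a,b,a',b')\in R\rangle$, where the symbol $a^{-1}$ is the inverse of $a$ in $\Gamma$. $R(i,j)$ is identified with $R(j,i)$ via $(a,b,a',b')\mapsto((b')^{-1},(a')^{-1},b^{-1},a^{-1})$. Conditions: C1: for each $(a,b,a',b')\in R$, each of $(a^{-1},(b')^{-1},(a')^{-1},b^{-1})$, $(a',b',a,b)$, $((a')^{-1},b^{-1},a^{-1},(b')^{-1})$ is in $R$, and the four 4-tuples are distinct. C2: for all $i\ne j$, each projection of $R(i,j)$ onto a subproduct of the form $E_i\times E_j$ or $E_j\times E_i$ is bijective. C3: for every $p\in\{1,\ldots,k\}$, $n\in\{2,\ldots,k\}$,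 $J\subseteq\{1,\ldots,k\}\setminus\{p\}$ with $|J|=n-1$, and every choice of $n-1$ elements $(u,v_j,u^j,w_j)\in R(p,j)$, $j\in J$ (with common $u\in E_p$), there are unique elements $u^L\in E_p$ ($L\subseteq J$) and $v_i^L,w_i^L\in E_i$ ($L\subseteq J$, $i\in J\setminus L$) extending the given ones ($u^\emptyset=u$, $u^{\{j\}}=u^j$, $v_j^\emptyset=v_j$, $w_j^\emptyset=w_j$) such that for all $L\subseteq J$ with $0\le|L|\le n-2$: (a) $(u^L,v_j^L,u^{L\cup\{j\}},w_j^L)\in R(p,j)$ for $j\in J\setminus L$; (b) $((v_i^L)^{-1},v_j^L,(w_i^{L\cup\{j\}})^{-1},w_j^{L\cup\{i\}})\in R(i,j)$ for $i\neq j$ in $J\setminus L$; (c) $(w_i^L,(w_j^L)^{-1},v_i^{L\cup\{j\}},(v_j^{L\cup\{i\}})^{-1})\in R(i,j)$ for $i\ne j$ in $J\setminus L$. $\Gamma$ is a $k$-cube group with adjacency structure $E_1,\ldots,E_k$ if C1, C2 hold and, when $k\ge 3$, also C3. **Pointed $k$-cubes.** Fix $p$ and $J=\{1,\ldots,k\}\setminus\{p\}$. A pointed $k$-cube $\square(u,v_J,u^J,w_J)$ is the system of all $u^L,v_i^L,w_i^L$ determined as in C3 by elements $(u,v_j,u^j,w_j)\in R(p,j)$, $j\in J$ (it labels the edges of a based oriented $k$-dimensional cube; different $p$ give the same set up to canonical identification). $\mathcal{S}_k=\mathcal{S}_k(\Gamma)$ is the set of pointed $k$-cubes. **Adjacency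 matrices.** $M_1,\ldots,M_k$ are the $\{0,1\}$-matrices indexed by $\mathcal{S}_k$ defined, for $A=\square(u,v_J,u^J,w_J)$ and $B=\square(x,y_J,x^J,z_J)$, by: - $M_p(A,B)=1$ iff for all $L\subseteq J$: $u^L\ne(x^L)^{-1}$, and for all $j\in J\setminus L$, $v_j^L=(z_j^L)^{-1}$ if $|L|$ is even and $w_j^L=(y_j^L)^{-1}$ if $|L|$ is odd. (That is, the face of $B$ through its basepoint transverse to direction $p$ equals the opposite such face of $A$, and $B$ is not the reflection of $A$ in that face.) - for $i\ne p$, $M_i(A,B)=1$ iff for all $L\subseteq J\setminus\{i\}$: $(x^L)^{-1}=u^{L\cup\{i\}}$; $(y_j^L)^{-1}=w_j^{L\cup\{i\}}$ and $(z_j^L)^{-1}=v_j^{L\cup\{i\}}$ for all $j\in J\setminus(L\cup\{i\})$; and $v_i^L\neq(y_i^L)^{-1}$, $w_i^L\ne(z_i^L)^{-1}$. **Rank-$k$ graphs.** A rank-$k$ graph $(\Lambda,d)$ is a countable small category $\Lambda$ (with range and source maps $r,s$) with a functor $d:\Lambda\to\mathbb{N}^k$ such that whenever $d(\lambda)=\mathbf m+\mathbf n$ there are unique morphisms $\mu,\nu$ with $\lambda=\nu\mu$, $d(\mu)=\mathbf m$, $d(\nu)=\mathbf n$. Write $\Lambda^{\mathbf n}=d^{-1}(\mathbf n)$; $\Lambda^{\mathbf 0}$ is the set of vertices (objects), and $v\Lambda^{\mathbf n}=\{\lambda\in\Lambda^{\mathbf n}: r(\lambda)=v\}$. $\Lambda$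 is row-finite if all $v\Lambda^{\mathbf n}$ are finite, and has no sources if all $v\Lambda^{\mathbf n}$ are non-empty. **$\mathcal{G}(\Gamma)$.** For $i=1,\ldots,k$ let $\mathcal{E}_i$ be the directed graph with vertex set $\mathcal{S}_k(\Gamma)$ and exactly one edge (of colour $i$) from $A$ to $B$ when $M_i(A,B)=1$ and none otherwise. $\mathcal{G}(\Gamma)$ is the quotient of the path category of the coloured graph $\mathcal{E}_1\cup\cdots\cup\mathcal{E}_k$ by the relation identifying, for $i\ne j$, each path of length two coloured $ij$ with the path coloured $ji$ having the same source and range. The $i$-th entry of $d(\lambda)$ is the number of edges of colour $i$ in $\lambda$. *)

theory Defs
  imports "HOL-Library.Countable_Set" "HOL-Algebra.Group"
begin

section \<open>Quotients by generated relations\<close>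

definition equiv_gen :: "'x set \<Rightarrow> 'x rel \<Rightarrow> 'x rel" where
  "equiv_gen W r = Restr ((r \<union> r\<inverse>)\<^sup>*) W"

text \<open>
  The group presented by an alphabet \<open>X\<close> and a set \<open>T\<close> of words declared trivial.  Words are
  taken in \<open>X\<close> itself, without formal inverses, so this is the group with that presentation
  only when \<open>X\<close> carries an involution \<open>x \<mapsto> x\<^sup>-\<close> and \<open>T\<close> contains all the words \<open>x x\<^sup>-\<close>, as is
  the case below.
\<close>

definition word_cong :: "'g set \<Rightarrow> 'g list set \<Rightarrow> 'g list rel" where
  "word_cong X T = equiv_gen (lists X)
     {(x @ t @ y, x @ y) | x t y. x \<in> lists X \<and> t \<in> T \<and> y \<in> lists X}"

definition presented_group :: "'g set \<Rightarrow> 'g list set \<Rightarrow> 'g list set monoid" where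
  "presented_group X T =
     \<lparr>carrier = lists X // word_cong X T,
      mult = (\<lambda>c d. \<Union>x\<in>c. \<Union>y\<in>d. word_cong X T `` {x @ y}),
      one = word_cong X T `` {[]}\<rparr>"


section \<open>Cube groups\<close>

text \<open>
  \<open>EdgeS D i\<close> is \<open>E\<^sub>i\<close>, \<open>einv D i\<close> its involution and \<open>Rel D i j\<close> is \<open>R(i,j)\<close>.  The disjoint
  unions over \<open>i\<close> and over \<open>(i,j)\<close> are encoded by the indices, so the sets \<open>E\<^sub>i\<close> may overlap
  inside \<open>'a\<close>.  Only indices in \<open>{1..k}\<close> (with \<open>i \<noteq> j\<close>) are ever looked at.
\<close>

record 'a adjacency =
  EdgeS :: "nat \<Rightarrow> 'a set"
  einv :: "nat \<Rightarrow> 'a \<Rightarrow> 'a"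
  Rel :: "nat \<Rightarrow> nat \<Rightarrow> ('a \<times> 'a \<times> 'a \<times> 'a) set"

definition edge_data :: "nat \<Rightarrow> 'a adjacency \<Rightarrow> bool" where
  "edge_data k D \<longleftrightarrow>
     (\<forall>i\<in>{1..k}. finite (EdgeS D i) \<and> (\<exists>m\<ge>2. card (EdgeS D i) = 2 * m) \<and>
        (\<forall>a\<in>EdgeS D i. einv D i a \<in> EdgeS D i \<and> einv D i (einv D i a) = a \<and> einv D i a \<noteq> a))"

text \<open>The second conjunct expresses the identification of \<open>R(i,j)\<close> with \<open>R(j,i)\<close>.\<close>

definition relation_data :: "nat \<Rightarrow> 'a adjacency \<Rightarrow> bool" where
  "relation_data k D \<longleftrightarrow>
     (\<forall>i\<in>{1..k}. \<forall>j\<in>{1..k}. i \<noteq> j \<longrightarrow>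
        Rel D i j \<subseteq> EdgeS D i \<times> EdgeS D j \<times> EdgeS D i \<times> EdgeS D j \<and>
        Rel D j i = (\<lambda>(a, b, a', b'). (einv D j b', einv D i a', einv D j b, einv D i a)) ` Rel D i j)"

definition C1 :: "nat \<Rightarrow> 'a adjacency \<Rightarrow> bool" where
  "C1 k D \<longleftrightarrow>
     (\<forall>i\<in>{1..k}. \<forall>j\<in>{1..k}. i \<noteq> j \<longrightarrow> (\<forall>(a, b, a', b')\<in>Rel D i j.
        (einv D i a, einv D j b', einv D i a', einv D j b) \<in> Rel D i j \<and>
        (a', b', a, b) \<in> Rel D i j \<and>
        (einv D i a', einv D j b, einv D i a, einv D j b') \<in> Rel D i j \<and>
        distinct [(a, b, a', b'),
                  (einv D i a, einv D j b', einv D i a', einv D j b),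
                  (a', b', a, b),
                  (einv D i a', einv D j b, einv D i a, einv D j b')]))"

definition C2 :: "nat \<Rightarrow> 'a adjacency \<Rightarrow> bool" where
  "C2 k D \<longleftrightarrow>
     (\<forall>i\<in>{1..k}. \<forall>j\<in>{1..k}. i \<noteq> j \<longrightarrow>
        bij_betw (\<lambda>(a, b, a', b'). (a, b)) (Rel D i j) (EdgeS D i \<times> EdgeS D j) \<and>
        bij_betw (\<lambda>(a, b, a', b'). (b, a')) (Rel D i j) (EdgeS D j \<times> EdgeS D i) \<and>
        bij_betw (\<lambda>(a, b, a', b'). (a', b')) (Rel D i j) (EdgeS D i \<times> EdgeS D j) \<and>
        bij_betw (\<lambda>(a, b, a', b'). (a, b')) (Rel D i j) (EdgeS D i \<times> EdgeS D j))"

record 'a cube =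
  cu :: "nat set \<Rightarrow> 'a"
  cv :: "nat \<Rightarrow> nat set \<Rightarrow> 'a"
  cw :: "nat \<Rightarrow> nat set \<Rightarrow> 'a"

text \<open>
  A cube is a system of elements \<open>u\<^sup>L\<close> (\<open>L \<subseteq> J\<close>) and \<open>v\<^sub>i\<^sup>L\<close>, \<open>w\<^sub>i\<^sup>L\<close> (\<open>L \<subseteq> J\<close>, \<open>i \<in> J - L\<close>).
  These have to lie in the right sets \<open>E\<^sub>i\<close>; at all other arguments they are
  \<open>undefined\<close>, so that two systems are equal as soon as they agree where they are meaningful.
\<close>

definition cube_typed :: "'a adjacency \<Rightarrow> nat \<Rightarrow> nat set \<Rightarrow> 'a cube \<Rightarrow> bool" where
  "cube_typed D p J C \<longleftrightarrow>
     (\<forall>L. if L \<subseteq> J then cu C L \<in> EdgeS D p else cu C L = undefined) \<and>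
     (\<forall>i L. if L \<subseteq> J \<and> i \<in> J - L then cv C i L \<in> EdgeS D i \<and> cw C i L \<in> EdgeS D i
            else cv C i L = undefined \<and> cw C i L = undefined)"

definition cube_relations :: "'a adjacency \<Rightarrow> nat \<Rightarrow> nat set \<Rightarrow> 'a cube \<Rightarrow> bool" where
  "cube_relations D p J C \<longleftrightarrow>
     (\<forall>L. L \<subseteq> J \<and> card L < card J \<longrightarrow>
        (\<forall>j\<in>J - L. (cu C L, cv C j L, cu C (L \<union> {j}), cw C j L) \<in> Rel D p j) \<and>
        (\<forall>i\<in>J - L. \<forall>j\<in>J - L. i \<noteq> j \<longrightarrow>
           (einv D i (cv C i L), cv C j L, einv D i (cw C i (L \<union> {j})), cw C j (L \<union> {i})) \<in> Rel D i j \<and>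
           (cw C i L, einv D j (cw C j L), cv C i (L \<union> {j}), einv D j (cv C j (L \<union> {i}))) \<in> Rel D i j))"

definition cube_corner ::
  "'a adjacency \<Rightarrow> nat \<Rightarrow> nat set \<Rightarrow> 'a \<Rightarrow> (nat \<Rightarrow> 'a) \<Rightarrow> (nat \<Rightarrow> 'a) \<Rightarrow> (nat \<Rightarrow> 'a) \<Rightarrow> bool" where
  "cube_corner D p J u v u' w \<longleftrightarrow> u \<in> EdgeS D p \<and> (\<forall>j\<in>J. (u, v j, u' j, w j) \<in> Rel D p j)"

text \<open>\<open>is_box D p J u v u' w C\<close> says that \<open>C\<close> is the cube \<open>\<box>(u, v\<^sub>J, u\<^sup>J, w\<^sub>J)\<close>.\<close>

definition is_box ::
  "'a adjacency \<Rightarrow> nat \<Rightarrow> nat set \<Rightarrow> 'a \<Rightarrow> (nat \<Rightarrow> 'a) \<Rightarrow> (nat \<Rightarrow> 'a) \<Rightarrow> (nat \<Rightarrow> 'a) \<Rightarrow> 'a cube \<Rightarrow> bool"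
where
  "is_box D p J u v u' w C \<longleftrightarrow>
     cube_typed D p J C \<and> cube_relations D p J C \<and>
     cu C {} = u \<and> (\<forall>j\<in>J. cu C {j} = u' j \<and> cv C j {} = v j \<and> cw C j {} = w j)"

definition C3 :: "nat \<Rightarrow> 'a adjacency \<Rightarrow> bool" where
  "C3 k D \<longleftrightarrow>
     (\<forall>p\<in>{1..k}. \<forall>n\<in>{2..k}. \<forall>J. J \<subseteq> {1..k} - {p} \<and> card J = n - 1 \<longrightarrow>
        (\<forall>u v u' w. cube_corner D p J u v u' w \<longrightarrow> (\<exists>!C. is_box D p J u v u' w C)))"

definition cube_generators :: "nat \<Rightarrow> 'a adjacency \<Rightarrow> (nat \<times> 'a) set" where
  "cube_generators k D = (SIGMA i:{1..k}. EdgeS D i)"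

definition cube_relators :: "nat \<Rightarrow> 'a adjacency \<Rightarrow> (nat \<times> 'a) list set" where
  "cube_relators k D =
     {[(i, a), (i, einv D i a)] | i a. i \<in> {1..k} \<and> a \<in> EdgeS D i} \<union>
     {[(i, a), (j, b), (i, a'), (j, b')] | i j a b a' b'.
        i \<in> {1..k} \<and> j \<in> {1..k} \<and> i \<noteq> j \<and> (a, b, a', b') \<in> Rel D i j}"

definition k_cube_group :: "nat \<Rightarrow> 'a adjacency \<Rightarrow> (nat \<times> 'a) list set monoid \<Rightarrow> bool" where
  "k_cube_group k D \<Gamma> \<longleftrightarrow>
     edge_data k D \<and> relation_data k D \<and>
     \<Gamma> = presented_group (cube_generators k D) (cube_relators k D) \<and>
     C1 k D \<and> C2 k D \<and> (k \<ge> 3 \<longrightarrow> C3 k D)"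


section \<open>Pointed cubes and adjacency matrices\<close>

definition pointed_cubes :: "nat \<Rightarrow> 'a adjacency \<Rightarrow> nat \<Rightarrow> 'a cube set" where
  "pointed_cubes k D p =
     {C. \<exists>u v u' w. cube_corner D p ({1..k} - {p}) u v u' w \<and> is_box D p ({1..k} - {p}) u v u' w C}"

text \<open>
  The square \<open>(u\<^sup>L, v\<^sub>j\<^sup>L, u\<^bsup>L \<union> {j}\<^esup>, w\<^sub>j\<^sup>L)\<close> is traversed cyclically and \<open>u\<^sup>L\<close> points away from the
  base face for even \<open>|L|\<close> and towards it for odd \<open>|L|\<close>; hence \<open>v\<^sub>j\<^sup>L\<close> lies in the face opposite
  to the basepoint for even \<open>|L|\<close> and in the base face for odd \<open>|L|\<close>, and conversely for \<open>w\<^sub>j\<^sup>L\<close>.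
\<close>

definition adjacent_p :: "'a adjacency \<Rightarrow> nat \<Rightarrow> nat set \<Rightarrow> 'a cube \<Rightarrow> 'a cube \<Rightarrow> bool" where
  "adjacent_p D p J A B \<longleftrightarrow>
     (\<forall>L. L \<subseteq> J \<longrightarrow>
        cu A L \<noteq> einv D p (cu B L) \<and>
        (\<forall>j\<in>J - L. if even (card L) then cv A j L = einv D j (cw B j L)
                   else cw A j L = einv D j (cv B j L)))"

definition adjacent_other :: "'a adjacency \<Rightarrow> nat \<Rightarrow> nat set \<Rightarrow> nat \<Rightarrow> 'a cube \<Rightarrow> 'a cube \<Rightarrow> bool" where
  "adjacent_other D p J i A B \<longleftrightarrow>
     (\<forall>L. L \<subseteq> J - {i} \<longrightarrow>
        einv D p (cu B L) = cu A (L \<union> {i}) \<and>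
        (\<forall>j\<in>J - (L \<union> {i}). einv D j (cv B j L) = cw A j (L \<union> {i}) \<and>
                            einv D j (cw B j L) = cv A j (L \<union> {i})) \<and>
        cv A i L \<noteq> einv D i (cv B i L) \<and> cw A i L \<noteq> einv D i (cw B i L))"

definition adj_matrix :: "nat \<Rightarrow> 'a adjacency \<Rightarrow> nat \<Rightarrow> nat \<Rightarrow> 'a cube \<Rightarrow> 'a cube \<Rightarrow> nat" where
  "adj_matrix k D p i A B =
     of_bool (if i = p then adjacent_p D p ({1..k} - {p}) A B
              else adjacent_other D p ({1..k} - {p}) i A B)"


section \<open>Rank-k graphs\<close>

record ('o, 'm) category_data =
  Obj :: "'o set"
  Mor :: "'m set"
  src :: "'m \<Rightarrow> 'o"
  rng :: "'m \<Rightarrow> 'o"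
  ident :: "'o \<Rightarrow> 'm"
  comp :: "'m \<Rightarrow> 'm \<Rightarrow> 'm"  \<comment> \<open>\<open>comp \<Lambda> g f\<close> is \<open>g f\<close>, meaningful when \<open>src g = rng f\<close>\<close>

locale small_category =
  fixes \<Lambda> :: "('o, 'm) category_data"
  assumes src_in: "f \<in> Mor \<Lambda> \<Longrightarrow> src \<Lambda> f \<in> Obj \<Lambda>"
    and rng_in: "f \<in> Mor \<Lambda> \<Longrightarrow> rng \<Lambda> f \<in> Obj \<Lambda>"
    and ident_in: "x \<in> Obj \<Lambda> \<Longrightarrow> ident \<Lambda> x \<in> Mor \<Lambda>"
    and src_ident: "x \<in> Obj \<Lambda> \<Longrightarrow> src \<Lambda> (ident \<Lambda> x) = x"
    and rng_ident: "x \<in> Obj \<Lambda> \<Longrightarrow> rng \<Lambda> (ident \<Lambda> x) = x"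
    and comp_in: "\<lbrakk>f \<in> Mor \<Lambda>; g \<in> Mor \<Lambda>; src \<Lambda> g = rng \<Lambda> f\<rbrakk> \<Longrightarrow> comp \<Lambda> g f \<in> Mor \<Lambda>"
    and src_comp: "\<lbrakk>f \<in> Mor \<Lambda>; g \<in> Mor \<Lambda>; src \<Lambda> g = rng \<Lambda> f\<rbrakk> \<Longrightarrow> src \<Lambda> (comp \<Lambda> g f) = src \<Lambda> f"
    and rng_comp: "\<lbrakk>f \<in> Mor \<Lambda>; g \<in> Mor \<Lambda>; src \<Lambda> g = rng \<Lambda> f\<rbrakk> \<Longrightarrow> rng \<Lambda> (comp \<Lambda> g f) = rng \<Lambda> g"
    and comp_ident_right: "f \<in> Mor \<Lambda> \<Longrightarrow> comp \<Lambda> f (ident \<Lambda> (src \<Lambda> f)) = f"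
    and comp_ident_left: "f \<in> Mor \<Lambda> \<Longrightarrow> comp \<Lambda> (ident \<Lambda> (rng \<Lambda> f)) f = f"
    and comp_assoc: "\<lbrakk>f \<in> Mor \<Lambda>; g \<in> Mor \<Lambda>; h \<in> Mor \<Lambda>; src \<Lambda> g = rng \<Lambda> f; src \<Lambda> h = rng \<Lambda> g\<rbrakk>
      \<Longrightarrow> comp \<Lambda> h (comp \<Lambda> g f) = comp \<Lambda> (comp \<Lambda> h g) f"

text \<open>The monoid \<open>\<nat>\<^sup>k\<close>, as functions vanishing outside \<open>{1..k}\<close> under pointwise addition.\<close>

definition multideg :: "nat \<Rightarrow> (nat \<Rightarrow> nat) set" where
  "multideg k = {n. \<forall>i. i \<notin> {1..k} \<longrightarrow> n i = 0}"

locale rank_k_graph = small_category \<Lambda> for \<Lambda> :: "('o, 'm) category_data" +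
  fixes k :: nat and d :: "'m \<Rightarrow> nat \<Rightarrow> nat"
  assumes countable_Obj: "countable (Obj \<Lambda>)"
    and countable_Mor: "countable (Mor \<Lambda>)"
    and degree_in: "f \<in> Mor \<Lambda> \<Longrightarrow> d f \<in> multideg k"
    and degree_ident: "x \<in> Obj \<Lambda> \<Longrightarrow> d (ident \<Lambda> x) = (\<lambda>i. 0)"
    and degree_comp: "\<lbrakk>f \<in> Mor \<Lambda>; g \<in> Mor \<Lambda>; src \<Lambda> g = rng \<Lambda> f\<rbrakk>
      \<Longrightarrow> d (comp \<Lambda> g f) = (\<lambda>i. d f i + d g i)"
    and factorisation: "\<lbrakk>l \<in> Mor \<Lambda>; m \<in> multideg k; n \<in> multideg k; d l = (\<lambda>i. m i + n i)\<rbrakk>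
      \<Longrightarrow> \<exists>!(\<mu>, \<nu>). \<mu> \<in> Mor \<Lambda> \<and> \<nu> \<in> Mor \<Lambda> \<and> src \<Lambda> \<nu> = rng \<Lambda> \<mu> \<and> l = comp \<Lambda> \<nu> \<mu> \<and> d \<mu> = m \<and> d \<nu> = n"

definition range_fibre ::
  "('o, 'm) category_data \<Rightarrow> ('m \<Rightarrow> nat \<Rightarrow> nat) \<Rightarrow> 'o \<Rightarrow> (nat \<Rightarrow> nat) \<Rightarrow> 'm set" where
  "range_fibre \<Lambda> d x n = {f \<in> Mor \<Lambda>. rng \<Lambda> f = x \<and> d f = n}"

definition row_finite :: "('o, 'm) category_data \<Rightarrow> nat \<Rightarrow> ('m \<Rightarrow> nat \<Rightarrow> nat) \<Rightarrow> bool" where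
  "row_finite \<Lambda> k d \<longleftrightarrow> (\<forall>x\<in>Obj \<Lambda>. \<forall>n\<in>multideg k. finite (range_fibre \<Lambda> d x n))"

definition no_sources :: "('o, 'm) category_data \<Rightarrow> nat \<Rightarrow> ('m \<Rightarrow> nat \<Rightarrow> nat) \<Rightarrow> bool" where
  "no_sources \<Lambda> k d \<longleftrightarrow> (\<forall>x\<in>Obj \<Lambda>. \<forall>n\<in>multideg k. range_fibre \<Lambda> d x n \<noteq> {})"


section \<open>Quotients of path categories of coloured graphs\<close>

text \<open>
  For a vertex set \<open>V\<close> and \<open>{0,1}\<close>-matrices \<open>M 1, \<dots>, M k\<close> the triple \<open>(i, A, B)\<close> is the edge of
  colour \<open>i\<close> from \<open>A\<close> to \<open>B\<close>.  A path is recorded with its source and its range; its edges are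
  listed in the order in which they are traversed, starting at the source.
\<close>

type_synonym 'v path = "'v \<times> (nat \<times> 'v \<times> 'v) list \<times> 'v"

definition coloured_edges :: "'v set \<Rightarrow> nat \<Rightarrow> (nat \<Rightarrow> 'v \<Rightarrow> 'v \<Rightarrow> nat) \<Rightarrow> (nat \<times> 'v \<times> 'v) set" where
  "coloured_edges V k M = {(i, A, B). i \<in> {1..k} \<and> A \<in> V \<and> B \<in> V \<and> M i A B = 1}"

fun is_walk :: "'v \<Rightarrow> (nat \<times> 'v \<times> 'v) list \<Rightarrow> 'v \<Rightarrow> bool" where
  "is_walk A [] B \<longleftrightarrow> A = B"
| "is_walk A ((i, X, Y) # es) B \<longleftrightarrow> A = X \<and> is_walk Y es B"

definition path_category ::
  "'v set \<Rightarrow> nat \<Rightarrow> (nat \<Rightarrow> 'v \<Rightarrow> 'v \<Rightarrow> nat) \<Rightarrow> ('v, 'v path) category_data" where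
  "path_category V k M =
     \<lparr>Obj = V,
      Mor = {(A, es, B). A \<in> V \<and> B \<in> V \<and> set es \<subseteq> coloured_edges V k M \<and> is_walk A es B},
      src = (\<lambda>(A, es, B). A),
      rng = (\<lambda>(A, es, B). B),
      ident = (\<lambda>A. (A, [], A)),
      comp = (\<lambda>(A', es', B') (A, es, B). (A, es @ es', B'))\<rparr>"

definition commuting_squares :: "'v set \<Rightarrow> nat \<Rightarrow> (nat \<Rightarrow> 'v \<Rightarrow> 'v \<Rightarrow> nat) \<Rightarrow> 'v path rel" where
  "commuting_squares V k M =
     {((A, es, B), (A, es', B)) | A es es' B.
        (A, es, B) \<in> Mor (path_category V k M) \<and> (A, es', B) \<in> Mor (path_category V k M) \<and>
        (\<exists>i j. i \<noteq> j \<and> map fst es = [i, j] \<and> map fst es' = [j, i])}"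

text \<open>The congruence generated by a relation between parallel morphisms.\<close>

definition category_cong :: "('o, 'm) category_data \<Rightarrow> 'm rel \<Rightarrow> 'm rel" where
  "category_cong \<Lambda> r = equiv_gen (Mor \<Lambda>)
     {(comp \<Lambda> h (comp \<Lambda> f g), comp \<Lambda> h (comp \<Lambda> f' g)) | f f' g h.
        (f, f') \<in> r \<and> g \<in> Mor \<Lambda> \<and> h \<in> Mor \<Lambda> \<and> src \<Lambda> f = rng \<Lambda> g \<and> src \<Lambda> h = rng \<Lambda> f}"

definition quotient_category :: "('o, 'm) category_data \<Rightarrow> 'm rel \<Rightarrow> ('o, 'm set) category_data" where
  "quotient_category \<Lambda> r =
     \<lparr>Obj = Obj \<Lambda>,
      Mor = Mor \<Lambda> // category_cong \<Lambda> r,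
      src = (\<lambda>c. the_elem (src \<Lambda> ` c)),
      rng = (\<lambda>c. the_elem (rng \<Lambda> ` c)),
      ident = (\<lambda>x. category_cong \<Lambda> r `` {ident \<Lambda> x}),
      comp = (\<lambda>c' c. \<Union>g\<in>c'. \<Union>f\<in>c. category_cong \<Lambda> r `` {comp \<Lambda> g f})\<rparr>"

definition path_degree :: "'v path \<Rightarrow> nat \<Rightarrow> nat" where
  "path_degree = (\<lambda>(A, es, B) i. length (filter (\<lambda>e. fst e = i) es))"

definition class_degree :: "'v path set \<Rightarrow> nat \<Rightarrow> nat" where
  "class_degree c = the_elem (path_degree ` c)"


text \<open>
  The category built from an adjacency structure; \<open>p\<close> is the direction in terms of which pointed
  cubes are written down.
\<close>

definition cube_graph ::
  "nat \<Rightarrow> 'a adjacency \<Rightarrow> nat \<Rightarrow> ('a cube, 'a cube path set) category_data" where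
  "cube_graph k D p =
     quotient_category
       (path_category (pointed_cubes k D p) k (adj_matrix k D p))
       (commuting_squares (pointed_cubes k D p) k (adj_matrix k D p))"

end

theory Submission
  imports Defs "HOL-Library.Multiset"
begin

text \<open>
  A pointed \<open>k\<close>-cube is a labelling of the edges of the \<open>k\<close>-dimensional cube.  Take subsets
  \<open>U\<close> of \<open>{1..k}\<close> as vertices and let \<open>f U i\<close> be the letter of \<open>E\<^sub>i\<close> read when \<open>U\<close> is left in
  direction \<open>i\<close>; traversing an edge backwards inverts its letter, and the word read around any
  two-dimensional face is a relator.  Written like this, no direction and no vertex is
  distinguished, and reflections of the cube carry labellings to labellings.  Conditions C2 and C3
  now say one thing: the letters leaving a single vertex can be chosen freely and determine the
  labelling (\<open>star_extends\<close>, \<open>star_determines\<close>), the latter also on every face.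
  
  An edge of colour \<open>i\<close> from \<open>A\<close> to \<open>B\<close> in the graph of the matrix \<open>M\<^sub>i\<close> means that \<open>B\<close> is stacked
  onto \<open>A\<close> in direction \<open>i\<close> without being its mirror image.  Because stars determine cubes and
  faces, this can be read off from the letters at one common vertex: they agree
  exactly off direction \<open>i\<close> (\<open>adjacent_at_vertex\<close>).  Hence, if \<open>B\<close> is stacked onto \<open>A\<close> in direction
  \<open>i\<close> and \<open>C\<close> onto \<open>B\<close> in direction \<open>j\<close>, the cube that fills the fourth position of the two by two
  block is obtained by prescribing its star at the vertex shared by all four cubes
  (\<open>adjacent_swap\<close>), and every intermediate cube of a path of two or three distinct colours
  is determined by the two ends of the path, because each of its letters at a suitable vertex belongs to
  one of these ends (\<open>adjacent_unique2\<close>, \<open>adjacent_unique3\<close>).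
  
  These facts about the coloured graph suffice (locale \<open>square_graph\<close>).  By commuting squares a path
  can be given any rearrangement of its word of colours, so factorisations of every degree exist.
  They are unique once equivalent paths with the same word of colours are equal.  To see this,
  move the first edge of colour \<open>i\<close> to the front of the path (\<open>pull\<close>).  The edge
  obtained and the class of the remaining path depend only on the class of the path
  (\<open>pull_swap\<close>); for three distinct colours this is the hexagon of rearrangements,
  which closes because three-coloured paths are determined by their ends.  Peeling off one edge after
  the other gives the claim.  Row-finiteness holds because there are finitely many cubes, and there
  are no sources because each \<open>E\<^sub>i\<close> has more than one letter, so that backtracking can be avoided.
\<close>

section \<open>Quotients of categories\<close>

lemma equiv_gen_equiv:
  assumes "r \<subseteq> W \<times> W"
  shows "equiv W (equiv_gen W r)"
proof -
  have "sym ((r \<union> r\<inverse>)\<^sup>*)"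
    by (intro sym_rtrancl) (auto simp: sym_def)
  then show ?thesis
    by (auto simp: equiv_gen_def equiv_def refl_on_def sym_def trans_def)
qed

lemma equiv_gen_induct [consumes 1, case_names refl step]:
  assumes "(x, y) \<in> equiv_gen W r" and "r \<subseteq> W \<times> W"
    and "P x" and "\<And>y z. y \<in> W \<Longrightarrow> P y \<Longrightarrow> (y, z) \<in> r \<or> (z, y) \<in> r \<Longrightarrow> P z"
  shows "P y"
proof -
  have "(x, y) \<in> (r \<union> r\<inverse>)\<^sup>*"
    using assms(1) by (simp add: equiv_gen_def)
  then show ?thesis
    by (induction rule: rtrancl_induct) (use assms(2-4) in blast)+
qed

lemma equiv_gen_base:
  assumes "r \<subseteq> W \<times> W" and "(x, y) \<in> r"
  shows "(x, y) \<in> equiv_gen W r"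
  using assms by (auto simp: equiv_gen_def)

locale parallel_relation = small_category \<Lambda> for \<Lambda> :: "('o, 'm) category_data" +
  fixes r :: "'m rel"
  assumes parallel: "(f, f') \<in> r \<Longrightarrow>
    f \<in> Mor \<Lambda> \<and> f' \<in> Mor \<Lambda> \<and> src \<Lambda> f = src \<Lambda> f' \<and> rng \<Lambda> f = rng \<Lambda> f'"
begin

abbreviation cong where "cong \<equiv> category_cong \<Lambda> r"

text \<open>
  The category congruence generated by \<open>r\<close> is, by definition, the equivalence closure of the pairs
  of \<open>r\<close> composed with morphisms on both sides.  Such pairs are stable under further composition,
  so that compatibility with composition carries over to the equivalence closure step by step.
\<close>

definition whiskered :: "'m rel" where
  "whiskered = {(comp \<Lambda> h (comp \<Lambda> f g), comp \<Lambda> h (comp \<Lambda> f' g)) | f f' g h.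
     (f, f') \<in> r \<and> g \<in> Mor \<Lambda> \<and> h \<in> Mor \<Lambda> \<and> src \<Lambda> f = rng \<Lambda> g \<and> src \<Lambda> h = rng \<Lambda> f}"

lemma cong_eq: "cong = equiv_gen (Mor \<Lambda>) whiskered"
  by (simp add: category_cong_def whiskered_def)

lemma whiskered_parallel:
  assumes "(x, y) \<in> whiskered"
  shows "x \<in> Mor \<Lambda> \<and> y \<in> Mor \<Lambda> \<and> src \<Lambda> x = src \<Lambda> y \<and> rng \<Lambda> x = rng \<Lambda> y"
proof -
  obtain f f' a h where 1: "x = comp \<Lambda> h (comp \<Lambda> f a)" "y = comp \<Lambda> h (comp \<Lambda> f' a)"
    and 2: "(f, f') \<in> r" "a \<in> Mor \<Lambda>" "h \<in> Mor \<Lambda>" "src \<Lambda> f = rng \<Lambda> a" "src \<Lambda> h = rng \<Lambda> f"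
    using assms by (auto simp: whiskered_def)
  show ?thesis
    using parallel[OF 2(1)] 2 unfolding 1 by (simp add: comp_in src_comp rng_comp)
qed

lemma whiskered_subset: "whiskered \<subseteq> Mor \<Lambda> \<times> Mor \<Lambda>"
  using whiskered_parallel by auto

lemma whiskered_comp_left:
  assumes "(x, y) \<in> whiskered" "g \<in> Mor \<Lambda>" "src \<Lambda> g = rng \<Lambda> x"
  shows "(comp \<Lambda> g x, comp \<Lambda> g y) \<in> whiskered"
proof -
  obtain f f' a h where 1: "x = comp \<Lambda> h (comp \<Lambda> f a)" "y = comp \<Lambda> h (comp \<Lambda> f' a)"
    and 2: "(f, f') \<in> r" "a \<in> Mor \<Lambda>" "h \<in> Mor \<Lambda>" "src \<Lambda> f = rng \<Lambda> a" "src \<Lambda> h = rng \<Lambda> f"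
    using assms(1) by (auto simp: whiskered_def)
  note 3 = parallel[OF 2(1)]
  have gh: "src \<Lambda> g = rng \<Lambda> h"
    using assms(3) 1 2 3 by (simp add: comp_in src_comp rng_comp)
  have "comp \<Lambda> g x = comp \<Lambda> (comp \<Lambda> g h) (comp \<Lambda> f a)"
    "comp \<Lambda> g y = comp \<Lambda> (comp \<Lambda> g h) (comp \<Lambda> f' a)"
    using 1 2 3 gh assms(2) by (simp_all add: comp_assoc comp_in src_comp rng_comp)
  moreover have "comp \<Lambda> g h \<in> Mor \<Lambda>" "src \<Lambda> (comp \<Lambda> g h) = rng \<Lambda> f"
    using 2 gh assms(2) by (simp_all add: comp_in src_comp)
  ultimately show ?thesis
    unfolding whiskered_def using 2 by blast
qed

lemma whiskered_comp_right:
  assumes "(x, y) \<in> whiskered" "g \<in> Mor \<Lambda>" "src \<Lambda> x = rng \<Lambda> g"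
  shows "(comp \<Lambda> x g, comp \<Lambda> y g) \<in> whiskered"
proof -
  obtain f f' a h where 1: "x = comp \<Lambda> h (comp \<Lambda> f a)" "y = comp \<Lambda> h (comp \<Lambda> f' a)"
    and 2: "(f, f') \<in> r" "a \<in> Mor \<Lambda>" "h \<in> Mor \<Lambda>" "src \<Lambda> f = rng \<Lambda> a" "src \<Lambda> h = rng \<Lambda> f"
    using assms(1) by (auto simp: whiskered_def)
  note 3 = parallel[OF 2(1)]
  have ag: "src \<Lambda> a = rng \<Lambda> g"
    using assms(3) 1 2 3 by (simp add: comp_in src_comp rng_comp)
  have "comp \<Lambda> x g = comp \<Lambda> h (comp \<Lambda> f (comp \<Lambda> a g))"
    "comp \<Lambda> y g = comp \<Lambda> h (comp \<Lambda> f' (comp \<Lambda> a g))"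
    using 1 2 3 ag assms(2) by (simp_all add: comp_assoc comp_in src_comp rng_comp)
  moreover have "comp \<Lambda> a g \<in> Mor \<Lambda>" "src \<Lambda> f = rng \<Lambda> (comp \<Lambda> a g)"
    using 2 ag assms(2) by (simp_all add: comp_in rng_comp)
  ultimately show ?thesis
    unfolding whiskered_def using 2 by blast
qed

lemma cong_induct [consumes 1, case_names refl step]:
  assumes "(f, f') \<in> cong" and "P f"
    and "\<And>x y. x \<in> Mor \<Lambda> \<Longrightarrow> P x \<Longrightarrow> (x, y) \<in> whiskered \<or> (y, x) \<in> whiskered \<Longrightarrow> P y"
  shows "P f'"
  using equiv_gen_induct[OF assms(1)[unfolded cong_eq] whiskered_subset, of P] assms(2,3) by blast

lemma cong_equiv: "equiv (Mor \<Lambda>) cong"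
  unfolding cong_eq by (rule equiv_gen_equiv[OF whiskered_subset])

lemma cong_Mor: "(f, f') \<in> cong \<Longrightarrow> f \<in> Mor \<Lambda> \<and> f' \<in> Mor \<Lambda>"
  by (auto simp: cong_eq equiv_gen_def)

lemma cong_refl: "f \<in> Mor \<Lambda> \<Longrightarrow> (f, f) \<in> cong"
  using cong_equiv by (auto simp: equiv_def refl_on_def)

lemma cong_sym: "(f, g) \<in> cong \<Longrightarrow> (g, f) \<in> cong"
  using cong_equiv by (auto simp: equiv_def sym_def)

lemma cong_trans: "(f, g) \<in> cong \<Longrightarrow> (g, h) \<in> cong \<Longrightarrow> (f, h) \<in> cong"
  using cong_equiv unfolding equiv_def trans_def by blast

lemma cong_parallel:
  assumes "(f, f') \<in> cong"
  shows "src \<Lambda> f' = src \<Lambda> f \<and> rng \<Lambda> f' = rng \<Lambda> f"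
  using assms by (induction rule: cong_induct) (auto dest: whiskered_parallel)

lemma cong_comp_left:
  assumes "(f, f') \<in> cong" "g \<in> Mor \<Lambda>" "src \<Lambda> g = rng \<Lambda> f"
  shows "(comp \<Lambda> g f, comp \<Lambda> g f') \<in> cong"
proof -
  have "rng \<Lambda> f' = rng \<Lambda> f \<and> (comp \<Lambda> g f, comp \<Lambda> g f') \<in> cong"
    using assms(1)
  proof (induction rule: cong_induct)
    case refl
    then show ?case
      using assms cong_Mor by (auto intro!: cong_refl comp_in)
  next
    case (step y z)
    have z: "rng \<Lambda> z = rng \<Lambda> f"
      using step whiskered_parallel by metis
    have "(comp \<Lambda> g y, comp \<Lambda> g z) \<in> whiskered \<or> (comp \<Lambda> g z, comp \<Lambda> g y) \<in> whiskered"
      using step z assms whiskered_comp_left by metis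
    then have "(comp \<Lambda> g y, comp \<Lambda> g z) \<in> cong"
      using equiv_gen_base[OF whiskered_subset] cong_sym unfolding cong_eq by blast
    then show ?case
      using z step cong_trans by blast
  qed
  then show ?thesis by simp
qed

lemma cong_comp_right:
  assumes "(f, f') \<in> cong" "g \<in> Mor \<Lambda>" "src \<Lambda> f = rng \<Lambda> g"
  shows "(comp \<Lambda> f g, comp \<Lambda> f' g) \<in> cong"
proof -
  have "src \<Lambda> f' = src \<Lambda> f \<and> (comp \<Lambda> f g, comp \<Lambda> f' g) \<in> cong"
    using assms(1)
  proof (induction rule: cong_induct)
    case refl
    then show ?case
      using assms cong_Mor by (auto intro!: cong_refl comp_in)
  next
    case (step y z)
    have z: "src \<Lambda> z = src \<Lambda> f"
      using step whiskered_parallel by metis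
    have "(comp \<Lambda> y g, comp \<Lambda> z g) \<in> whiskered \<or> (comp \<Lambda> z g, comp \<Lambda> y g) \<in> whiskered"
      using step z assms whiskered_comp_right by metis
    then have "(comp \<Lambda> y g, comp \<Lambda> z g) \<in> cong"
      using equiv_gen_base[OF whiskered_subset] cong_sym unfolding cong_eq by blast
    then show ?case
      using z step cong_trans by blast
  qed
  then show ?thesis by simp
qed

lemma cong_comp:
  assumes "(f, f') \<in> cong" "(g, g') \<in> cong" "src \<Lambda> g = rng \<Lambda> f"
  shows "(comp \<Lambda> g f, comp \<Lambda> g' f') \<in> cong"
  by (metis assms cong_Mor cong_comp_left cong_comp_right cong_parallel cong_trans)

abbreviation cls :: "'m \<Rightarrow> 'm set" where "cls f \<equiv> cong `` {f}"

abbreviation quot where "quot \<equiv> quotient_category \<Lambda> r"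

lemma Obj_quot: "Obj quot = Obj \<Lambda>"
  by (simp add: quotient_category_def)

lemma Mor_quot: "Mor quot = cls ` Mor \<Lambda>"
  by (simp add: quotient_category_def quotient_def image_def) blast

lemma cls_eq_iff: "f \<in> Mor \<Lambda> \<Longrightarrow> g \<in> Mor \<Lambda> \<Longrightarrow> cls f = cls g \<longleftrightarrow> (f, g) \<in> cong"
  using eq_equiv_class_iff[OF cong_equiv] by blast

lemma the_elem_cls:
  assumes "f \<in> Mor \<Lambda>" "\<And>f'. (f, f') \<in> cong \<Longrightarrow> \<phi> f' = \<phi> f"
  shows "the_elem (\<phi> ` cls f) = \<phi> f"
proof -
  have "f \<in> cls f"
    using assms(1) cong_refl by blast
  then have "\<phi> ` cls f = {\<phi> f}"
    using assms(2) by (intro equalityI subsetI) (blast | force)+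
  then show ?thesis by simp
qed

lemma src_quot: "f \<in> Mor \<Lambda> \<Longrightarrow> src quot (cls f) = src \<Lambda> f"
  using the_elem_cls[of f "src \<Lambda>"] cong_parallel by (simp add: quotient_category_def)

lemma rng_quot: "f \<in> Mor \<Lambda> \<Longrightarrow> rng quot (cls f) = rng \<Lambda> f"
  using the_elem_cls[of f "rng \<Lambda>"] cong_parallel by (simp add: quotient_category_def)

lemma ident_quot: "ident quot x = cls (ident \<Lambda> x)"
  by (simp add: quotient_category_def)

lemma comp_quot:
  assumes "f \<in> Mor \<Lambda>" "g \<in> Mor \<Lambda>" "src \<Lambda> g = rng \<Lambda> f"
  shows "comp quot (cls g) (cls f) = cls (comp \<Lambda> g f)"
proof -
  have "cls (comp \<Lambda> g' f') = cls (comp \<Lambda> g f)" if "g' \<in> cls g" "f' \<in> cls f" for f' g'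
    using equiv_class_eq[OF cong_equiv cong_comp] that assms(3) by blast
  then have "(\<Union>g'\<in>cls g. \<Union>f'\<in>cls f. cls (comp \<Lambda> g' f'))
      = (\<Union>g'\<in>cls g. \<Union>f'\<in>cls f. cls (comp \<Lambda> g f))"
    by simp
  also have "\<dots> = cls (comp \<Lambda> g f)"
    using cong_refl assms by auto
  finally show ?thesis
    by (simp add: quotient_category_def)
qed

lemma small_category_quot: "small_category quot"
proof
  show "src quot f \<in> Obj quot" if "f \<in> Mor quot" for f
    using that by (auto simp: Mor_quot Obj_quot src_quot src_in)
  show "rng quot f \<in> Obj quot" if "f \<in> Mor quot" for f
    using that by (auto simp: Mor_quot Obj_quot rng_quot rng_in)
  show "ident quot x \<in> Mor quot" if "x \<in> Obj quot" for x
    using that by (auto simp: Mor_quot Obj_quot ident_quot ident_in)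
  show "src quot (ident quot x) = x" if "x \<in> Obj quot" for x
    using that by (auto simp: Obj_quot ident_quot ident_in src_quot src_ident)
  show "rng quot (ident quot x) = x" if "x \<in> Obj quot" for x
    using that by (auto simp: Obj_quot ident_quot ident_in rng_quot rng_ident)
  show "comp quot g f \<in> Mor quot"
    if "f \<in> Mor quot" "g \<in> Mor quot" "src quot g = rng quot f" for f g
    using that by (auto simp: Mor_quot src_quot rng_quot comp_quot comp_in)
  show "src quot (comp quot g f) = src quot f"
    if "f \<in> Mor quot" "g \<in> Mor quot" "src quot g = rng quot f" for f g
    using that by (auto simp: Mor_quot src_quot rng_quot comp_quot comp_in src_comp)
  show "rng quot (comp quot g f) = rng quot g"
    if "f \<in> Mor quot" "g \<in> Mor quot" "src quot g = rng quot f" for f g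
    using that by (auto simp: Mor_quot src_quot rng_quot comp_quot comp_in rng_comp)
  show "comp quot f (ident quot (src quot f)) = f" if "f \<in> Mor quot" for f
    using that
    by (auto simp: Mor_quot src_quot ident_quot comp_quot ident_in src_in rng_ident comp_ident_right)
  show "comp quot (ident quot (rng quot f)) f = f" if "f \<in> Mor quot" for f
    using that
    by (auto simp: Mor_quot rng_quot ident_quot comp_quot ident_in rng_in src_ident comp_ident_left)
  show "comp quot h (comp quot g f) = comp quot (comp quot h g) f"
    if "f \<in> Mor quot" "g \<in> Mor quot" "h \<in> Mor quot"
      "src quot g = rng quot f" "src quot h = rng quot g" for f g h
    using that
    by (auto simp: Mor_quot src_quot rng_quot comp_quot comp_in src_comp rng_comp comp_assoc)
qed

end

section \<open>Coloured graphs with unique commuting squares\<close>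

lemma is_walk_append:
  "is_walk A (es @ fs) B \<longleftrightarrow> (\<exists>C. is_walk A es C \<and> is_walk C fs B)"
  by (induction A es B rule: is_walk.induct) auto

lemma coloured_edgesD:
  "(i, A, B) \<in> coloured_edges V k M \<Longrightarrow> i \<in> {1..k} \<and> A \<in> V \<and> B \<in> V"
  by (simp add: coloured_edges_def)

lemma is_walk_range_in:
  "\<lbrakk>is_walk A es B; A \<in> V; set es \<subseteq> coloured_edges V k M\<rbrakk> \<Longrightarrow> B \<in> V"
  by (induction A es B rule: is_walk.induct) (auto dest: coloured_edgesD)

lemma is_walk_two:
  "is_walk A es B \<Longrightarrow> map fst es = [i, j] \<Longrightarrow> \<exists>C. es = [(i, A, C), (j, C, B)]"
  by (auto simp: map_eq_Cons_conv)

lemma Mor_path: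
  "(A, es, B) \<in> Mor (path_category V k M) \<longleftrightarrow>
     A \<in> V \<and> B \<in> V \<and> set es \<subseteq> coloured_edges V k M \<and> is_walk A es B"
  by (simp add: path_category_def)

lemma path_category_simps [simp]:
  "Obj (path_category V k M) = V"
  "src (path_category V k M) (A, es, B) = A"
  "rng (path_category V k M) (A, es, B) = B"
  "ident (path_category V k M) A = (A, [], A)"
  "comp (path_category V k M) (A', es', B') (A, es, B) = (A, es @ es', B')"
  by (simp_all add: path_category_def)

lemma small_category_path: "small_category (path_category V k M)"
  by unfold_locales (auto simp: Mor_path is_walk_append)

lemma path_degree_eq_count: "path_degree (A, es, B) = count (mset (map fst es))"
proof
  show "path_degree (A, es, B) i = count (mset (map fst es)) i" for i
    by (induction es) (auto simp: path_degree_def)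
qed

text \<open>
  The coherence condition for three colours is \<open>unique3\<close>: the two ways of turning a path with
  colours \<open>i, j, l\<close> into one with colours \<open>l, j, i\<close> end in paths with the same ends, and such a path is
  unique.  \<open>swap_exists\<close> and \<open>unique2\<close> together make the completion of a square unique.
\<close>

locale square_graph =
  fixes V :: "'v set" and k :: nat and M :: "nat \<Rightarrow> 'v \<Rightarrow> 'v \<Rightarrow> nat"
  assumes finite_V: "finite V"
    and swap_exists: "\<lbrakk>(i, A, B) \<in> coloured_edges V k M; (j, B, C) \<in> coloured_edges V k M; i \<noteq> j\<rbrakk>
      \<Longrightarrow> \<exists>B'. (j, A, B') \<in> coloured_edges V k M \<and> (i, B', C) \<in> coloured_edges V k M"
    and unique2: "\<lbrakk>(i, A, B) \<in> coloured_edges V k M; (j, B, C) \<in> coloured_edges V k M;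
        (i, A, B') \<in> coloured_edges V k M; (j, B', C) \<in> coloured_edges V k M; i \<noteq> j\<rbrakk> \<Longrightarrow> B = B'"
    and unique3: "\<lbrakk>(i, A, B) \<in> coloured_edges V k M; (j, B, C) \<in> coloured_edges V k M;
        (l, C, X) \<in> coloured_edges V k M;
        (i, A, B') \<in> coloured_edges V k M; (j, B', C') \<in> coloured_edges V k M;
        (l, C', X) \<in> coloured_edges V k M; distinct [i, j, l]\<rbrakk> \<Longrightarrow> B = B' \<and> C = C'"
    and edge_into: "\<lbrakk>B \<in> V; i \<in> {1..k}\<rbrakk> \<Longrightarrow> \<exists>A. (i, A, B) \<in> coloured_edges V k M"
begin

abbreviation E where "E \<equiv> coloured_edges V k M"

text \<open>
  One commuting square applied inside a list of edges.  Squares keep source and range, so on paths with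
  given end points the closure \<open>swaps\<close> is the congruence that defines the quotient.
\<close>

inductive swap :: "(nat \<times> 'v \<times> 'v) list \<Rightarrow> (nat \<times> 'v \<times> 'v) list \<Rightarrow> bool" where
  swap_here: "\<lbrakk>(i, A, B) \<in> E; (j, B, C) \<in> E; (j, A, B') \<in> E; (i, B', C) \<in> E; i \<noteq> j\<rbrakk>
    \<Longrightarrow> swap ((i, A, B) # (j, B, C) # es) ((j, A, B') # (i, B', C) # es)"
| swap_later: "swap es fs \<Longrightarrow> swap (e # es) (e # fs)"

abbreviation swaps where "swaps \<equiv> swap\<^sup>*\<^sup>*"

lemma swap_sym: "swap es fs \<Longrightarrow> swap fs es"
  by (induction rule: swap.induct) (auto intro: swap.intros)

lemma swap_append_left: "swap es fs \<Longrightarrow> swap (g @ es) (g @ fs)"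
  by (induction g) (auto intro: swap_later)

lemma swap_append_right: "swap es fs \<Longrightarrow> swap (es @ g) (fs @ g)"
  by (induction rule: swap.induct) (auto intro: swap.intros)

lemma swaps_append:
  assumes "swaps es fs" "swaps es' fs'"
  shows "swaps (es @ es') (fs @ fs')"
proof -
  have "swaps (es @ es') (fs @ es')"
    using assms(1) by induction (auto intro: swap_append_right rtranclp.rtrancl_into_rtrancl)
  also have "swaps (fs @ es') (fs @ fs')"
    using assms(2) by induction (auto intro: swap_append_left rtranclp.rtrancl_into_rtrancl)
  finally show ?thesis .
qed

lemma swaps_Cons: "swaps es fs \<Longrightarrow> swaps (e # es) (e # fs)"
  using swaps_append[of "[e]" "[e]"] by simp

lemma swap_context:
  assumes "swap es fs"
  shows "\<exists>g i A B j C B' h. es = g @ [(i, A, B), (j, B, C)] @ h \<and> fs = g @ [(j, A, B'), (i, B', C)] @ h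
    \<and> (i, A, B) \<in> E \<and> (j, B, C) \<in> E \<and> (j, A, B') \<in> E \<and> (i, B', C) \<in> E \<and> i \<noteq> j"
  using assms
proof induction
  case (swap_here i A B j C B' es)
  show ?case
    by (rule exI[of _ "[]"]) (use swap_here in auto)
next
  case (swap_later es fs e)
  then obtain g i A B j C B' h where "es = g @ [(i, A, B), (j, B, C)] @ h"
    "fs = g @ [(j, A, B'), (i, B', C)] @ h"
    "(i, A, B) \<in> E \<and> (j, B, C) \<in> E \<and> (j, A, B') \<in> E \<and> (i, B', C) \<in> E \<and> i \<noteq> j"
    by blast
  then show ?case
    by (intro exI[of _ "e # g"] exI[of _ i] exI[of _ A] exI[of _ B] exI[of _ j] exI[of _ C]
        exI[of _ B'] exI[of _ h]) simp
qed

lemma swaps_walk: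
  assumes "swaps es fs" "is_walk A es B" "set es \<subseteq> E"
  shows "is_walk A fs B \<and> set fs \<subseteq> E"
  using assms(1)
proof induction
  case base
  then show ?case using assms by simp
next
  case (step fs gs)
  then show ?case
    using swap_context[OF step(2)] by (auto simp: is_walk_append)
qed

lemma swaps_mset: "swaps es fs \<Longrightarrow> mset (map fst fs) = mset (map fst es)"
proof (induction rule: rtranclp_induct)
  case (step fs gs)
  from step(2) have "mset (map fst gs) = mset (map fst fs)"
    by induction auto
  with step show ?case by simp
qed simp

text \<open>
  Moving the first edge of colour \<open>i\<close> to the front, past one edge of another colour at a time.
  Only the edges in front of it change, each within a commuting square.
\<close>

inductive pull :: "nat \<Rightarrow> (nat \<times> 'v \<times> 'v) list \<Rightarrow> nat \<times> 'v \<times> 'v \<Rightarrow> (nat \<times> 'v \<times> 'v) list \<Rightarrow> bool"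
  for i where
  pull_here: "pull i ((i, A, B) # es) (i, A, B) es"
| pull_later: "\<lbrakk>j \<noteq> i; pull i es (i, B, C) es'; (j, A, B) \<in> E; (i, B, C) \<in> E; (i, A, B') \<in> E; (j, B', C) \<in> E\<rbrakk>
    \<Longrightarrow> pull i ((j, A, B) # es) (i, A, B') ((j, B', C) # es')"

lemma pull_swaps: "pull i es e es' \<Longrightarrow> swaps es (e # es')"
proof (induction rule: pull.induct)
  case (pull_later j es B C es' A B')
  have "swaps ((j, A, B) # es) ((j, A, B) # (i, B, C) # es')"
    using pull_later by (intro swaps_Cons)
  also have "swap \<dots> ((i, A, B') # (j, B', C) # es')"
    using pull_later by (intro swap_here) auto
  finally show ?case .
qed simp

lemma pull_exists:
  assumes "i \<in> fst ` set es" "is_walk A es X" "set es \<subseteq> E"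
  shows "\<exists>B es'. pull i es (i, A, B) es' \<and> (i, A, B) \<in> E"
  using assms
proof (induction es arbitrary: A)
  case (Cons x es)
  obtain j B where x: "x = (j, A, B)" and B: "is_walk B es X"
    using Cons.prems(2) by (cases x) auto
  show ?case
  proof (cases "j = i")
    case True
    then show ?thesis
      using Cons.prems x by (auto intro: pull_here)
  next
    case False
    then obtain C es' where C: "pull i es (i, B, C) es'" "(i, B, C) \<in> E"
      using Cons.IH[of B] Cons.prems x B by auto
    obtain B' where "(i, A, B') \<in> E" "(j, B', C) \<in> E"
      using swap_exists[of j A B i C] False C Cons.prems x by auto
    then show ?thesis
      using pull_later[OF False C(1) _ C(2)] Cons.prems x by auto
  qed
qed simp

text \<open>
  The effect of \<open>pull\<close> is invariant under a commuting square.  If the pulled edge belongs to the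
  square, this is the uniqueness of the square.  If it comes from behind the square, it passes both
  edges of the square, and the two routes around the hexagon lead to the same path.
\<close>

lemma pull_swap:
  assumes "swap es fs" "pull i es e es'"
  shows "\<exists>fs'. pull i fs e fs' \<and> swaps es' fs'"
  using assms
proof (induction arbitrary: e es' rule: swap.induct)
  case (swap_here a A B b C B' q)
  show ?case
  proof (cases "a = i")
    case True
    then have e: "e = (i, A, B)" "es' = (b, B, C) # q"
      using swap_here.prems by (auto elim: pull.cases)
    have "pull i ((b, A, B') # (i, B', C) # q) (i, A, B) ((b, B, C) # q)"
      using swap_here.hyps True by (intro pull_later pull_here) auto
    then show ?thesis
      using e True by blast
  next
    case a: False
    then obtain D X r where X: "pull i ((b, B, C) # q) (i, B, D) r" "(i, B, D) \<in> E"
      "(i, A, X) \<in> E" "(a, X, D) \<in> E" "e = (i, A, X)" "es' = (a, X, D) # r"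
      using swap_here.prems by (auto elim: pull.cases)
    show ?thesis
    proof (cases "b = i")
      case True
      then have "D = C" "r = q"
        using X(1) by (auto elim: pull.cases)
      moreover have "X = B'"
        using unique2[of i A X a C B'] X True swap_here.hyps a \<open>D = C\<close> by auto
      ultimately show ?thesis
        using X True pull_here by blast
    next
      case b: False
      \<comment> \<open>The edge of colour \<open>i\<close> lies behind the square; \<open>Z\<close>, \<open>W\<close> and \<open>Z\'\<close> carry it along the other side.\<close>
      obtain F q' where F: "pull i q (i, C, F) q'" "(i, C, F) \<in> E" "(b, D, F) \<in> E" "r = (b, D, F) # q'"
        using X(1) b by (auto elim: pull.cases)
      obtain Z where Z: "(i, B', Z) \<in> E" "(a, Z, F) \<in> E"
        using swap_exists[of a B' C i F] swap_here.hyps F a by blast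
      obtain W where W: "(i, A, W) \<in> E" "(b, W, Z) \<in> E"
        using swap_exists[of b A B' i Z] swap_here.hyps Z b by blast
      obtain Z' where Z': "(a, W, Z') \<in> E" "(b, Z', F) \<in> E"
        using swap_exists[of b W Z a F] swap_here.hyps Z W by metis
      have "W = X \<and> Z' = D"
        using unique3[of i A W a Z' b F X D] W Z' X F a b swap_here.hyps by auto
      then have WX: "W = X" "Z' = D" by auto
      have "pull i ((b, A, B') # (a, B', C) # q) (i, A, X) ((b, X, Z) # (a, Z, F) # q')"
        using swap_here.hyps F Z W WX a b X by (intro pull_later) auto
      moreover have "swap ((a, X, D) # (b, D, F) # q') ((b, X, Z) # (a, Z, F) # q')"
        using X F Z W WX swap_here.hyps by (intro swap.swap_here) auto
      ultimately show ?thesis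
        using X F by blast
    qed
  qed
next
  case (swap_later es fs x)
  from swap_later.prems show ?case
  proof cases
    case (pull_here A B)
    then show ?thesis
      using swap_later.hyps pull.pull_here by blast
  next
    case (pull_later j B C r A B')
    obtain fs' where "pull i fs (i, B, C) fs'" "swaps r fs'"
      using swap_later.IH[OF pull_later(5)] by blast
    then show ?thesis
      using pull_later pull.pull_later swaps_Cons by blast
  qed
qed

lemma pull_swaps_invariant:
  assumes "swaps es fs" "pull i es e es'"
  shows "\<exists>fs'. pull i fs e fs' \<and> swaps es' fs'"
  using assms(1)
proof induction
  case base
  then show ?case using assms(2) by blast
next
  case (step fs gs)
  then obtain fs' where fs': "pull i fs e fs'" "swaps es' fs'" by blast
  obtain gs' where "pull i gs e gs'" "swaps fs' gs'"
    using pull_swap[OF step(2) fs'(1)] by blast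
  then show ?case
    using rtranclp_trans[OF fs'(2)] by blast
qed

text \<open>
  Pulling the colour of the first edge leaves a list unchanged.  So two equivalent lists whose words of
  colours coincide have the same first edge and equivalent tails.
\<close>

lemma swaps_same_colours_eq:
  assumes "swaps es fs" "map fst es = map fst fs"
  shows "es = fs"
  using assms
proof (induction es arbitrary: fs)
  case (Cons e es)
  obtain i A B where e: "e = (i, A, B)" by (cases e)
  obtain f fs1 where fs: "fs = f # fs1" "fst f = i" "map fst es = map fst fs1"
    using Cons.prems(2) e by (cases fs) auto
  obtain fs' where fs': "pull i fs e fs'" "swaps es fs'"
    using pull_swaps_invariant[OF Cons.prems(1)] pull_here[of i A B es] unfolding e by blast
  from fs'(1) have "f = e \<and> fs' = fs1"
    using fs by (cases rule: pull.cases) auto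
  then show ?case
    using Cons.IH[of fs1] fs fs' by simp
qed simp

lemma swaps_rearrange:
  assumes "mset w = mset (map fst es)" "is_walk A es B" "set es \<subseteq> E"
  shows "\<exists>fs. swaps es fs \<and> map fst fs = w"
  using assms
proof (induction w arbitrary: A es)
  case (Cons i w)
  have "i \<in> set (map fst es)"
    using mset_eq_setD[OF Cons.prems(1)] by auto
  then have "i \<in> fst ` set es" by simp
  from pull_exists[OF this Cons.prems(2,3)]
  obtain C es' where C: "pull i es (i, A, C) es'" by blast
  note sw = pull_swaps[OF C]
  have "is_walk C es' B" "set es' \<subseteq> E"
    using swaps_walk[OF sw] Cons.prems by auto
  moreover have "mset w = mset (map fst es')"
    using swaps_mset[OF sw] Cons.prems(1)
    by (metis add_mset_add_mset_same_iff fst_conv list.simps(9) mset.simps(2))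
  ultimately obtain fs where fs: "swaps es' fs" "map fst fs = w"
    using Cons.IH by blast
  have "swaps es ((i, A, C) # fs)"
    by (rule rtranclp_trans[OF sw swaps_Cons[OF fs(1)]])
  moreover have "map fst ((i, A, C) # fs) = i # w"
    using fs(2) by simp
  ultimately show ?case by (intro exI conjI)
qed auto

abbreviation Path where "Path \<equiv> path_category V k M"
abbreviation squares where "squares \<equiv> commuting_squares V k M"

sublocale parallel_relation Path squares
proof -
  interpret small_category Path by (rule small_category_path)
  show "parallel_relation Path squares"
    by unfold_locales (auto simp: commuting_squares_def)
qed

lemma swap_cong:
  assumes "swap es fs" "(A, es, B) \<in> Mor Path"
  shows "((A, es, B), (A, fs, B)) \<in> cong"
proof -
  obtain g i X Y j Z Y' h where 1: "es = g @ [(i, X, Y), (j, Y, Z)] @ h"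
    "fs = g @ [(j, X, Y'), (i, Y', Z)] @ h"
    and 2: "(i, X, Y) \<in> E" "(j, Y, Z) \<in> E" "(j, X, Y') \<in> E" "(i, Y', Z) \<in> E" "i \<noteq> j"
    using swap_context[OF assms(1)] by blast
  have sq: "((X, [(i, X, Y), (j, Y, Z)], Z), (X, [(j, X, Y'), (i, Y', Z)], Z)) \<in> squares"
    using 2 by (auto simp: commuting_squares_def Mor_path dest: coloured_edgesD)
  have gh: "(A, g, X) \<in> Mor Path" "(Z, h, B) \<in> Mor Path"
    using assms(2) coloured_edgesD[OF 2(1)] coloured_edgesD[OF 2(2)]
    by (auto simp: Mor_path 1 is_walk_append)
  have "(comp Path (Z, h, B) (comp Path (X, [(i, X, Y), (j, Y, Z)], Z) (A, g, X)),
      comp Path (Z, h, B) (comp Path (X, [(j, X, Y'), (i, Y', Z)], Z) (A, g, X))) \<in> whiskered"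
    unfolding whiskered_def by (rule CollectI, intro exI conjI, rule refl, rule sq, rule gh, rule gh) simp_all
  then show ?thesis
    using equiv_gen_base[OF whiskered_subset] 1 by (simp add: cong_eq)
qed

lemma whiskered_swap:
  assumes "((A, es, B), (A', fs, B')) \<in> whiskered"
  shows "A' = A \<and> B' = B \<and> swap es fs"
proof -
  obtain f f' g h where 1: "(A, es, B) = comp Path h (comp Path f g)"
    "(A', fs, B') = comp Path h (comp Path f' g)"
    and 2: "(f, f') \<in> squares"
    using assms by (auto simp: whiskered_def)
  obtain X xs ys Y i j where f: "f = (X, xs, Y)" "f' = (X, ys, Y)" "i \<noteq> j"
    "map fst xs = [i, j]" "map fst ys = [j, i]"
    "set xs \<subseteq> E" "set ys \<subseteq> E" "is_walk X xs Y" "is_walk X ys Y"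
    using 2 by (auto simp: commuting_squares_def Mor_path)
  obtain P where P: "xs = [(i, X, P), (j, P, Y)]"
    using is_walk_two f by metis
  obtain Q where Q: "ys = [(j, X, Q), (i, Q, Y)]"
    using is_walk_two f by metis
  have "swap xs ys"
    using swap_here[of i X P j Y Q "[]"] f P Q by auto
  moreover obtain G0 gs G1 where "g = (G0, gs, G1)" by (cases g)
  moreover obtain H0 hs H1 where "h = (H0, hs, H1)" by (cases h)
  ultimately show ?thesis
    using 1 f swap_append_left swap_append_right by auto
qed

lemma cong_iff_swaps:
  assumes "(A, es, B) \<in> Mor Path"
  shows "((A, es, B), (A', fs, B')) \<in> cong \<longleftrightarrow> A' = A \<and> B' = B \<and> swaps es fs"
proof
  assume "((A, es, B), (A', fs, B')) \<in> cong"
  then have "case (A', fs, B') of (A', fs, B') \<Rightarrow> A' = A \<and> B' = B \<and> swaps es fs"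
  proof (induction rule: cong_induct)
    case (step P Q)
    obtain X xs Y where P: "P = (X, xs, Y)" by (cases P)
    obtain X' ys Y' where Q: "Q = (X', ys, Y')" by (cases Q)
    have "X' = X \<and> Y' = Y \<and> swap xs ys"
      using step.hyps(2) whiskered_swap swap_sym unfolding P Q by blast
    then show ?case
      using step.IH P Q by auto
  qed simp
  then show "A' = A \<and> B' = B \<and> swaps es fs" by simp
next
  assume a: "A' = A \<and> B' = B \<and> swaps es fs"
  then have "swaps es fs" by simp
  then have "((A, es, B), (A, fs, B)) \<in> cong"
  proof induction
    case base
    then show ?case using assms cong_refl by blast
  next
    case (step fs gs)
    then show ?case
      using swap_cong cong_Mor cong_trans by blast
  qed
  then show "((A, es, B), (A', fs, B')) \<in> cong"
    using a by simp
qed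

lemma class_degree_cls:
  assumes "(A, es, B) \<in> Mor Path"
  shows "class_degree (cls (A, es, B)) = count (mset (map fst es))"
proof -
  have "class_degree (cls (A, es, B)) = path_degree (A, es, B)"
    unfolding class_degree_def
  proof (rule the_elem_cls[OF assms])
    show "path_degree P = path_degree (A, es, B)" if "((A, es, B), P) \<in> cong" for P
      using that cong_iff_swaps[OF assms] swaps_mset
      by (cases P) (metis path_degree_eq_count)
  qed
  then show ?thesis
    by (simp add: path_degree_eq_count)
qed

lemma multideg_word:
  assumes "n \<in> multideg k"
  shows "\<exists>w. set w \<subseteq> {1..k} \<and> count (mset w) = n"
proof -
  have "{i. 0 < n i} \<subseteq> {1..k}"
    using assms by (fastforce simp: multideg_def)
  then have "finite {i. 0 < n i}"
    by (rule finite_subset) simp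
  then have c: "count (Abs_multiset n) = n"
    by (simp add: count_Abs_multiset)
  obtain w where w: "mset w = Abs_multiset n"
    using ex_mset by blast
  have "n i > 0" if "i \<in> set w" for i
    using that w c by (metis count_greater_zero_iff set_mset_mset)
  with \<open>{i. 0 < n i} \<subseteq> {1..k}\<close> w c show ?thesis by (metis mem_Collect_eq subset_iff)
qed

lemma walk_into:
  assumes "B \<in> V" "set w \<subseteq> {1..k}"
  shows "\<exists>A es. (A, es, B) \<in> Mor Path \<and> map fst es = w"
  using assms
proof (induction w arbitrary: B rule: rev_induct)
  case Nil
  then show ?case
    by (intro exI[of _ B] exI[of _ "[]"]) (simp add: Mor_path)
next
  case (snoc i w)
  obtain C where C: "(i, C, B) \<in> E"
    using edge_into[of B i] snoc.prems by auto
  then obtain A es where "(A, es, C) \<in> Mor Path" "map fst es = w"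
    using snoc.IH[of C] snoc.prems(2) coloured_edgesD[OF C] by auto
  then have "(A, es @ [(i, C, B)], B) \<in> Mor Path \<and> map fst (es @ [(i, C, B)]) = w @ [i]"
    using C snoc.prems by (auto simp: Mor_path is_walk_append)
  then show ?case by blast
qed

lemma finite_E: "finite E"
proof (rule finite_subset)
  show "E \<subseteq> {1..k} \<times> V \<times> V"
    by (auto simp: coloured_edges_def)
qed (simp add: finite_V)

lemma countable_Mor_quot: "countable (Mor quot)"
proof -
  have "Mor Path \<subseteq> V \<times> lists E \<times> V"
    by (auto simp: Mor_path)
  moreover have "countable (V \<times> lists E \<times> V)"
    using finite_E finite_V by (intro countable_SIGMA countable_lists) (auto intro: countable_finite)
  ultimately show ?thesis
    unfolding Mor_quot by (meson countable_image countable_subset)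
qed

lemma factorisation_exists:
  assumes P: "P \<in> Mor quot" and mn: "m \<in> multideg k" "n \<in> multideg k"
    and deg: "class_degree P = (\<lambda>i. m i + n i)"
  shows "\<exists>\<mu> \<nu>. \<mu> \<in> Mor quot \<and> \<nu> \<in> Mor quot \<and> src quot \<nu> = rng quot \<mu> \<and> P = comp quot \<nu> \<mu>
    \<and> class_degree \<mu> = m \<and> class_degree \<nu> = n"
proof -
  obtain A es B where es: "P = cls (A, es, B)" "(A, es, B) \<in> Mor Path"
    using P by (auto simp: Mor_quot)
  obtain w where w: "count (mset w) = m"
    using multideg_word[OF mn(1)] by blast
  obtain w' where w': "count (mset w') = n"
    using multideg_word[OF mn(2)] by blast
  have "mset (w @ w') = mset (map fst es)"
    using deg w w' class_degree_cls[OF es(2)] es(1) by (intro multiset_eqI) auto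
  then obtain fs where fs: "swaps es fs" "map fst fs = w @ w'"
    using swaps_rearrange es(2) by (metis Mor_path)
  obtain gs hs where gh: "fs = gs @ hs" "map fst gs = w" "map fst hs = w'"
    using fs(2) by (metis map_eq_append_conv)
  have "is_walk A fs B \<and> set fs \<subseteq> E"
    using swaps_walk fs es(2) by (metis Mor_path)
  then obtain C where "is_walk A gs C" "is_walk C hs B" "set gs \<subseteq> E" "set hs \<subseteq> E"
    using gh by (auto simp: is_walk_append)
  then have paths: "(A, gs, C) \<in> Mor Path" "(C, hs, B) \<in> Mor Path"
    using es(2) is_walk_range_in by (auto simp: Mor_path)
  have "comp quot (cls (C, hs, B)) (cls (A, gs, C)) = cls (A, fs, B)"
    using comp_quot[OF paths] gh by simp
  also have "\<dots> = P"
    using cong_iff_swaps[OF es(2)] fs(1) cls_eq_iff cong_Mor es by metis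
  finally show ?thesis
    using paths gh w w'
    by (intro exI[of _ "cls (A, gs, C)"] exI[of _ "cls (C, hs, B)"])
      (auto simp: Mor_quot src_quot rng_quot class_degree_cls)
qed

text \<open>
  Both factorisations are rearranged so that corresponding factors have the same word of colours; then
  the composed paths are equivalent with equal words, hence equal, and so are their initial and final parts.
\<close>

lemma factorisation_unique:
  assumes \<mu>: "\<mu> \<in> Mor quot" "\<mu>' \<in> Mor quot" and \<nu>: "\<nu> \<in> Mor quot" "\<nu>' \<in> Mor quot"
    and comp: "src quot \<nu> = rng quot \<mu>" "src quot \<nu>' = rng quot \<mu>'"
    and eq: "comp quot \<nu> \<mu> = comp quot \<nu>' \<mu>'"
    and deg: "class_degree \<mu> = class_degree \<mu>'" "class_degree \<nu> = class_degree \<nu>'"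
  shows "\<mu> = \<mu>' \<and> \<nu> = \<nu>'"
proof -
  obtain A gs C where gs: "\<mu> = cls (A, gs, C)" "(A, gs, C) \<in> Mor Path"
    using \<mu>(1) by (auto simp: Mor_quot)
  obtain A' gs' C' where gs': "\<mu>' = cls (A', gs', C')" "(A', gs', C') \<in> Mor Path"
    using \<mu>(2) by (auto simp: Mor_quot)
  obtain hs B where hs: "\<nu> = cls (C, hs, B)" "(C, hs, B) \<in> Mor Path"
    using \<nu>(1) comp(1) gs by (auto simp: Mor_quot src_quot rng_quot)
  obtain hs' B' where hs': "\<nu>' = cls (C', hs', B')" "(C', hs', B') \<in> Mor Path"
    using \<nu>(2) comp(2) gs' by (auto simp: Mor_quot src_quot rng_quot)
  have "mset (map fst gs) = mset (map fst gs')" "mset (map fst hs) = mset (map fst hs')"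
    using deg gs gs' hs hs' by (simp_all add: class_degree_cls count_inject)
  then obtain gs2 hs2 where g2: "swaps gs' gs2" "map fst gs2 = map fst gs"
    and h2: "swaps hs' hs2" "map fst hs2 = map fst hs"
    using swaps_rearrange gs' hs' by (metis Mor_path)
  have paths: "(A, gs @ hs, B) \<in> Mor Path" "(A', gs' @ hs', B') \<in> Mor Path"
    using gs hs gs' hs' by (auto simp: Mor_path is_walk_append)
  have "cls (A, gs @ hs, B) = cls (A', gs' @ hs', B')"
    using eq gs gs' hs hs' by (simp add: comp_quot)
  then have ends: "A' = A" "B' = B" and "swaps (gs @ hs) (gs' @ hs')"
    using cls_eq_iff[OF paths] cong_iff_swaps[OF paths(1)] by auto
  then have "swaps (gs @ hs) (gs2 @ hs2)"
    using swaps_append[OF g2(1) h2(1)] by simp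
  then have "gs @ hs = gs2 @ hs2"
    by (rule swaps_same_colours_eq) (simp add: g2 h2)
  then have "gs2 = gs" "hs2 = hs"
    using g2(2) by (metis append_eq_append_conv length_map)+
  have walk: "is_walk A gs C'" "set gs' \<subseteq> E"
    using swaps_walk[OF g2(1)] gs' ends \<open>gs2 = gs\<close> by (auto simp: Mor_path)
  have "C' = C"
  proof -
    have "C1 = C2" if "is_walk X xs C1" "is_walk X xs C2" for X and xs :: "(nat \<times> 'v \<times> 'v) list" and C1 C2
      using that by (induction X xs C1 rule: is_walk.induct) auto
    then show ?thesis
      using walk gs(2) by (auto simp: Mor_path)
  qed
  have "((A', gs', C'), (A, gs, C)) \<in> cong" "((C', hs', B'), (C, hs, B)) \<in> cong"
    using cong_iff_swaps gs'(2) hs'(2) g2 h2 \<open>gs2 = gs\<close> \<open>hs2 = hs\<close> ends \<open>C' = C\<close> by auto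
  then show ?thesis
    using gs hs gs' hs' cls_eq_iff by metis
qed

theorem rank_k_graph_quot: "rank_k_graph quot k class_degree"
proof -
  interpret Q: small_category quot by (rule small_category_quot)
  show ?thesis
  proof
    show "countable (Obj quot)"
      using finite_V by (simp add: Obj_quot countable_finite)
    show "countable (Mor quot)"
      by (rule countable_Mor_quot)
    show "class_degree f \<in> multideg k" if f: "f \<in> Mor quot" for f
    proof -
      obtain A es B where es: "f = cls (A, es, B)" "(A, es, B) \<in> Mor Path"
        using f by (auto simp: Mor_quot)
      have "fst ` set es \<subseteq> {1..k}"
        using es(2) by (auto simp: Mor_path dest!: subsetD coloured_edgesD)
      then show ?thesis
        using es by (auto simp: class_degree_cls multideg_def not_in_iff[symmetric])
    qed
    show "class_degree (ident quot x) = (\<lambda>i. 0)" if "x \<in> Obj quot" for x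
      using that ident_in[of x] by (auto simp: Obj_quot ident_quot class_degree_cls)
    show "class_degree (comp quot g f) = (\<lambda>i. class_degree f i + class_degree g i)"
      if fg: "f \<in> Mor quot" "g \<in> Mor quot" "src quot g = rng quot f" for f g
    proof -
      obtain A es B where es: "f = cls (A, es, B)" "(A, es, B) \<in> Mor Path"
        using fg by (auto simp: Mor_quot)
      obtain fs C where fs: "g = cls (B, fs, C)" "(B, fs, C) \<in> Mor Path"
        using fg es by (auto simp: Mor_quot src_quot rng_quot)
      have "(A, es @ fs, C) \<in> Mor Path"
        using es fs by (auto simp: Mor_path is_walk_append)
      then show ?thesis
        using es fs by (auto simp: comp_quot class_degree_cls)
    qed
    show "\<exists>!(\<mu>, \<nu>). \<mu> \<in> Mor quot \<and> \<nu> \<in> Mor quot \<and> src quot \<nu> = rng quot \<mu>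
        \<and> l = comp quot \<nu> \<mu> \<and> class_degree \<mu> = m \<and> class_degree \<nu> = n"
      if l: "l \<in> Mor quot" "m \<in> multideg k" "n \<in> multideg k" "class_degree l = (\<lambda>i. m i + n i)" for l m n
    proof -
      obtain \<mu> \<nu> where ex: "\<mu> \<in> Mor quot" "\<nu> \<in> Mor quot" "src quot \<nu> = rng quot \<mu>"
        "l = comp quot \<nu> \<mu>" "class_degree \<mu> = m" "class_degree \<nu> = n"
        using factorisation_exists[OF l] by blast
      have unique: "\<mu>' = \<mu> \<and> \<nu>' = \<nu>" if "\<mu>' \<in> Mor quot" "\<nu>' \<in> Mor quot" "src quot \<nu>' = rng quot \<mu>'"
        "l = comp quot \<nu>' \<mu>'" "class_degree \<mu>' = m" "class_degree \<nu>' = n" for \<mu>' \<nu>'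
        using that ex by (intro factorisation_unique) simp_all
      show ?thesis
      proof (rule ex1I[of _ "(\<mu>, \<nu>)"])
        fix q
        assume q: "case q of (\<mu>, \<nu>) \<Rightarrow> \<mu> \<in> Mor quot \<and> \<nu> \<in> Mor quot \<and> src quot \<nu> = rng quot \<mu>
          \<and> l = comp quot \<nu> \<mu> \<and> class_degree \<mu> = m \<and> class_degree \<nu> = n"
        obtain \<mu>' \<nu>' where "q = (\<mu>', \<nu>')" by (cases q)
        with q unique[of \<mu>' \<nu>'] show "q = (\<mu>, \<nu>)" by simp
      qed (use ex in simp)
    qed
  qed
qed

theorem row_finite_quot: "row_finite quot k class_degree"
  unfolding row_finite_def
proof (intro ballI)
  fix x n
  assume "n \<in> multideg k"
  then obtain w where w: "count (mset w) = n"
    using multideg_word by blast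
  let ?L = "{es. set es \<subseteq> E \<and> length es = length w}"
  have "range_fibre quot class_degree x n \<subseteq> cls ` (V \<times> ?L \<times> V)"
  proof
    fix f assume "f \<in> range_fibre quot class_degree x n"
    then obtain A es B where es: "f = cls (A, es, B)" "(A, es, B) \<in> Mor Path" "class_degree f = n"
      by (auto simp: range_fibre_def Mor_quot)
    then have "mset (map fst es) = mset w"
      using w by (simp add: class_degree_cls flip: count_inject)
    then have "length es = length w"
      by (metis length_map size_mset)
    then show "f \<in> cls ` (V \<times> ?L \<times> V)"
      using es by (auto simp: Mor_path)
  qed
  moreover have "finite (cls ` (V \<times> ?L \<times> V))"
    using finite_V finite_lists_length_eq[OF finite_E] by simp
  ultimately show "finite (range_fibre quot class_degree x n)"
    by (rule finite_subset)
qed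

theorem no_sources_quot: "no_sources quot k class_degree"
  unfolding no_sources_def
proof (intro ballI)
  fix x n
  assume x: "x \<in> Obj quot" and "n \<in> multideg k"
  then obtain w where w: "set w \<subseteq> {1..k}" "count (mset w) = n"
    using multideg_word by blast
  obtain A es where "(A, es, x) \<in> Mor Path" "map fst es = w"
    using walk_into[of x w] w(1) x by (auto simp: Obj_quot)
  then have "cls (A, es, x) \<in> range_fibre quot class_degree x n"
    using w by (auto simp: range_fibre_def Mor_quot rng_quot class_degree_cls)
  then show "range_fibre quot class_degree x n \<noteq> {}" by blast
qed

end

section \<open>Labelled cubes\<close>

text \<open>
  Vertices of the cube are sets of directions; crossing an edge of direction \<open>i\<close> toggles \<open>i\<close>.
\<close>

definition flip :: "'b \<Rightarrow> 'b set \<Rightarrow> 'b set" where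
  "flip i U = sym_diff U {i}"

lemma flip_notin: "i \<notin> U \<Longrightarrow> flip i U = insert i U"
  by (auto simp: flip_def)

lemma flip_in: "i \<in> U \<Longrightarrow> flip i U = U - {i}"
  by (auto simp: flip_def)

lemma flip_flip [simp]: "flip i (flip i U) = U"
  by (auto simp: flip_def)

lemma flip_commute: "flip i (flip j U) = flip j (flip i U)"
  by (auto simp: flip_def)

lemma in_flip: "j \<in> flip i U \<longleftrightarrow> (if j = i then i \<notin> U else j \<in> U)"
  by (auto simp: flip_def)

lemma flip_subset: "U \<subseteq> X \<Longrightarrow> i \<in> X \<Longrightarrow> flip i U \<subseteq> X"
  by (auto simp: flip_def)

lemma flip_sym_diff: "sym_diff (flip i U) T = flip i (sym_diff U T)"
  by (auto simp: flip_def)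

lemma flip_Un: "i \<notin> Z \<Longrightarrow> flip i U \<union> Z = flip i (U \<union> Z)"
  by (auto simp: flip_def)

lemma even_card_flip: "finite U \<Longrightarrow> even (card (flip i U)) \<longleftrightarrow> odd (card U)"
  by (cases "i \<in> U") (auto simp: flip_in flip_notin card_Diff_singleton_if card_gt_0_iff)

definition reversible :: "'a adjacency \<Rightarrow> nat set \<Rightarrow> (nat set \<Rightarrow> nat \<Rightarrow> 'a) \<Rightarrow> bool" where
  "reversible D X f \<longleftrightarrow>
     (\<forall>U\<subseteq>X. \<forall>i\<in>X. f U i \<in> EdgeS D i \<and> f (flip i U) i = einv D i (f U i))"

lemma reversibleD:
  assumes "reversible D X f" "U \<subseteq> X" "j \<in> X"
  shows "f U j \<in> EdgeS D j" "f (flip j U) j = einv D j (f U j)"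
  using assms by (auto simp: reversible_def)

text \<open>
  The word read when leaving \<open>U\<close> in direction \<open>i\<close> and walking around the face in directions
  \<open>i, j, i, j\<close>, back to \<open>U\<close>.
\<close>

definition square_at :: "'a adjacency \<Rightarrow> (nat set \<Rightarrow> nat \<Rightarrow> 'a) \<Rightarrow> nat set \<Rightarrow> nat \<Rightarrow> nat \<Rightarrow> bool" where
  "square_at D f U i j \<longleftrightarrow>
     (f U i, f (flip i U) j, f (flip j (flip i U)) i, f (flip j U) j) \<in> Rel D i j"

definition labelling :: "'a adjacency \<Rightarrow> nat set \<Rightarrow> (nat set \<Rightarrow> nat \<Rightarrow> 'a) \<Rightarrow> bool" where
  "labelling D X f \<longleftrightarrow>
     reversible D X f \<and> (\<forall>U\<subseteq>X. \<forall>i\<in>X. \<forall>j\<in>X. i \<noteq> j \<longrightarrow> square_at D f U i j)"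

lemma labellingD:
  assumes "labelling D X f"
  shows "\<lbrakk>U \<subseteq> X; i \<in> X\<rbrakk> \<Longrightarrow> f U i \<in> EdgeS D i"
    and "\<lbrakk>U \<subseteq> X; i \<in> X\<rbrakk> \<Longrightarrow> f (flip i U) i = einv D i (f U i)"
    and "\<lbrakk>U \<subseteq> X; i \<in> X; j \<in> X; i \<noteq> j\<rbrakk> \<Longrightarrow> square_at D f U i j"
  using assms by (auto simp: labelling_def reversible_def)

text \<open>
  The map \<open>U \<mapsto> sym_diff U T\<close> is the reflection of the cube that carries the vertex \<open>{}\<close> to \<open>T\<close>.
  It commutes with crossing edges, so what holds at the base vertex holds at every vertex.
\<close>

lemma labelling_translate:
  assumes "labelling D X f" "T \<subseteq> X"
  shows "labelling D X (\<lambda>U. f (sym_diff U T))"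
proof -
  have T: "sym_diff U T \<subseteq> X" if "U \<subseteq> X" for U
    using that assms(2) by auto
  show ?thesis
    unfolding labelling_def reversible_def square_at_def flip_sym_diff
    using labellingD(1,2)[OF assms(1) T] labellingD(3)[OF assms(1) T, unfolded square_at_def]
    by blast
qed

lemma labelling_face:
  assumes "labelling D X f" "Y \<subseteq> X" "Z \<subseteq> X - Y"
  shows "labelling D Y (\<lambda>U. f (U \<union> Z))"
proof -
  have Z: "U \<union> Z \<subseteq> X" if "U \<subseteq> Y" for U
    using that assms(2,3) by auto
  have fl: "flip i U \<union> Z = flip i (U \<union> Z)" if "i \<in> Y" for i U
    using that assms(3) by (intro flip_Un) auto
  show ?thesis
    unfolding labelling_def reversible_def square_at_def
    using labellingD(1,2)[OF assms(1) Z] labellingD(3)[OF assms(1) Z, unfolded square_at_def] assms(2)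
    by (auto simp: fl subset_iff)
qed

locale cube_structure =
  fixes k :: nat and D :: "'a adjacency"
  assumes k2: "k \<ge> 2"
    and edge_data: "edge_data k D"
    and relation_data: "relation_data k D"
    and C1: "C1 k D"
    and C2: "C2 k D"
    and C3: "k \<ge> 3 \<Longrightarrow> C3 k D"
begin

abbreviation bar where "bar \<equiv> einv D"

lemma bar_in: "\<lbrakk>i \<in> {1..k}; a \<in> EdgeS D i\<rbrakk> \<Longrightarrow> bar i a \<in> EdgeS D i"
  and bar_bar: "\<lbrakk>i \<in> {1..k}; a \<in> EdgeS D i\<rbrakk> \<Longrightarrow> bar i (bar i a) = a"
  using edge_data by (auto simp: edge_data_def)

lemma bar_eq_iff:
  assumes "i \<in> {1..k}" "a \<in> EdgeS D i" "b \<in> EdgeS D i"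
  shows "bar i a = bar i b \<longleftrightarrow> a = b" "bar i a = b \<longleftrightarrow> a = bar i b"
  using assms bar_bar by metis+

lemma finite_edges: "i \<in> {1..k} \<Longrightarrow> finite (EdgeS D i)"
  using edge_data by (simp add: edge_data_def)

lemma other_edge:
  assumes "i \<in> {1..k}"
  shows "\<exists>b\<in>EdgeS D i. b \<noteq> a"
proof -
  obtain m where m: "m \<ge> 2" "card (EdgeS D i) = 2 * m"
    using edge_data assms unfolding edge_data_def by blast
  have "\<not> EdgeS D i \<subseteq> {a}"
    using m card_mono[of "{a}" "EdgeS D i"] by auto
  then show ?thesis by auto
qed

lemma Rel_subset:
  assumes "i \<in> {1..k}" "j \<in> {1..k}" "i \<noteq> j" "(a, b, a', b') \<in> Rel D i j"
  shows "a \<in> EdgeS D i" "b \<in> EdgeS D j" "a' \<in> EdgeS D i" "b' \<in> EdgeS D j"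
  using relation_data assms unfolding relation_data_def by blast+

lemma Rel_symmetric:
  assumes "i \<in> {1..k}" "j \<in> {1..k}" "i \<noteq> j" "(a, b, a', b') \<in> Rel D i j"
  shows "(bar i a, bar j b', bar i a', bar j b) \<in> Rel D i j"
    and "(bar i a', bar j b, bar i a, bar j b') \<in> Rel D i j"
  using C1 assms unfolding C1_def by fastforce+

lemma Rel_swap:
  assumes "i \<in> {1..k}" "j \<in> {1..k}" "i \<noteq> j" "(a, b, a', b') \<in> Rel D i j"
  shows "(bar j b', bar i a', bar j b, bar i a) \<in> Rel D j i"
proof -
  have "Rel D j i = (\<lambda>(a, b, a', b'). (bar j b', bar i a', bar j b, bar i a)) ` Rel D i j"
    using relation_data assms(1-3) unfolding relation_data_def by blast
  then show ?thesis
    using assms(4) by force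
qed

lemma square_unique:
  assumes "i \<in> {1..k}" "j \<in> {1..k}" "i \<noteq> j" "(a, b, a', b') \<in> Rel D i j" "(a, c, c', b') \<in> Rel D i j"
  shows "c = b" "c' = a'"
proof -
  have "inj_on (\<lambda>(a, b, a', b'). (a, b')) (Rel D i j)"
    using C2 assms(1-3) unfolding C2_def bij_betw_def by blast
  from inj_onD[OF this _ assms(4,5)] show "c = b" "c' = a'" by auto
qed

lemma square_exists:
  assumes "i \<in> {1..k}" "j \<in> {1..k}" "i \<noteq> j" "a \<in> EdgeS D i" "b' \<in> EdgeS D j"
  shows "\<exists>b a'. (a, b, a', b') \<in> Rel D i j"
proof -
  have "(\<lambda>(a, b, a', b'). (a, b')) ` Rel D i j = EdgeS D i \<times> EdgeS D j"
    using C2 assms(1-3) unfolding C2_def bij_betw_def by blast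
  then have "(a, b') \<in> (\<lambda>(a, b, a', b'). (a, b')) ` Rel D i j"
    using assms(4,5) by simp
  then show ?thesis by auto
qed

text \<open>
  The symmetries in C1, together with the identification of \<open>R(i,j)\<close> with \<open>R(j,i)\<close>, are the rereadings
  of a relator from another corner of its face or with the other orientation.
\<close>

lemma square_at_flip:
  assumes f: "reversible D X f" "X \<subseteq> {1..k}" and U: "U \<subseteq> X" and ij: "i \<in> X" "j \<in> X" "i \<noteq> j"
    and sq: "square_at D f U i j"
  shows "square_at D f (flip i U) i j" "square_at D f (flip j U) i j" "square_at D f U j i"
proof -
  have k: "i \<in> {1..k}" "j \<in> {1..k}"
    using f(2) ij by auto
  have rev: "f (flip l W) l = bar l (f W l)" if "W \<subseteq> X" "l \<in> X" for W l
    using f(1) that by (auto simp: reversible_def)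
  have sub: "flip i U \<subseteq> X" "flip j U \<subseteq> X" "flip j (flip i U) \<subseteq> X"
    using U ij by (simp_all add: flip_subset)
  have e: "bar i (f U i) = f (flip i U) i" "bar j (f (flip i U) j) = f (flip j (flip i U)) j"
    "bar i (f (flip j (flip i U)) i) = f (flip j U) i" "bar j (f (flip j U) j) = f U j"
    using rev[of U i] rev[of "flip i U" j] rev[of "flip j (flip i U)" i] rev[of "flip j U" j] U ij sub
    by (simp_all add: flip_commute[of i j])
  note sq' = sq[unfolded square_at_def]
  show "square_at D f (flip i U) i j" "square_at D f (flip j U) i j" "square_at D f U j i"
    using Rel_symmetric[OF k ij(3) sq'] Rel_swap[OF k ij(3) sq'] unfolding e
    by (simp_all add: square_at_def flip_commute[of i j])
qed

lemma square_at_same_face: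
  assumes f: "reversible D X f" "X \<subseteq> {1..k}" and U: "U \<subseteq> X" and ij: "i \<in> X" "j \<in> X" "i \<noteq> j"
    and W: "W \<subseteq> X" "W - {i, j} = U - {i, j}" and sq: "square_at D f W i j"
  shows "square_at D f U i j"
proof -
  have sub: "flip i W \<subseteq> X" using W ij by (simp add: flip_subset)
  have "U = W \<or> U = flip i W \<or> U = flip j W \<or> U = flip j (flip i W)"
  proof -
    have other: "l \<in> U \<longleftrightarrow> l \<in> W" if "l \<noteq> i" "l \<noteq> j" for l
      using W(2) that by blast
    define Z where "Z = (if i \<in> U \<longleftrightarrow> i \<in> W then W else flip i W)"
    define Z' where "Z' = (if j \<in> U \<longleftrightarrow> j \<in> W then Z else flip j Z)"
    have "l \<in> U \<longleftrightarrow> l \<in> Z'" for l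
      using other[of l] ij(3) unfolding Z'_def Z_def by (simp add: in_flip)
    then have "U = Z'" by blast
    then show ?thesis
      unfolding Z'_def Z_def by metis
  qed
  then show ?thesis
    using square_at_flip[OF f W(1) ij sq] square_at_flip[OF f sub ij] sq by blast
qed

end

section \<open>Pointed cubes as labelled cubes\<close>

text \<open>
  Over \<open>L\<close> there are two vertices of the cube, \<open>L\<close> and \<open>insert p L\<close>, one with an even and one with an
  odd number of elements.  In a pointed cube the orientation of an edge alternates with \<open>|L|\<close>.
  This alternation is a choice of one orientation of each edge: \<open>u\<^sup>L\<close> is read
  leaving the even vertex over \<open>L\<close>, while \<open>v\<^sub>j\<^sup>L\<close> and \<open>w\<^sub>j\<^sup>L\<close> are read leaving the odd vertices
  over \<open>L\<close> and \<open>insert j L\<close>.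
\<close>

definition evenv :: "nat \<Rightarrow> nat set \<Rightarrow> nat set" where
  "evenv p L = (if even (card L) then L else insert p L)"

definition oddv :: "nat \<Rightarrow> nat set \<Rightarrow> nat set" where
  "oddv p L = (if even (card L) then insert p L else L)"

definition represents :: "nat \<Rightarrow> nat set \<Rightarrow> 'a cube \<Rightarrow> (nat set \<Rightarrow> nat \<Rightarrow> 'a) \<Rightarrow> bool" where
  "represents p J C f \<longleftrightarrow> (\<forall>L\<subseteq>J. cu C L = f (evenv p L) p \<and>
     (\<forall>j\<in>J - L. cv C j L = f (oddv p L) j \<and> cw C j L = f (oddv p (insert j L)) j))"

definition cube_of :: "nat \<Rightarrow> nat set \<Rightarrow> (nat set \<Rightarrow> nat \<Rightarrow> 'a) \<Rightarrow> 'a cube" where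
  "cube_of p J f =
     \<lparr>cu = \<lambda>L. if L \<subseteq> J then f (evenv p L) p else undefined,
      cv = \<lambda>j L. if L \<subseteq> J \<and> j \<in> J - L then f (oddv p L) j else undefined,
      cw = \<lambda>j L. if L \<subseteq> J \<and> j \<in> J - L then f (oddv p (insert j L)) j else undefined\<rparr>"

text \<open>
  Here \<open>e U\<close> is the recorded letter when \<open>U\<close> has the parity at which edges of direction \<open>j\<close> are
  recorded; from the other end of the edge the inverse is read.
\<close>

definition label :: "'a adjacency \<Rightarrow> nat \<Rightarrow> 'a cube \<Rightarrow> nat set \<Rightarrow> nat \<Rightarrow> 'a" where
  "label D p C U j =
     (let e = (\<lambda>U. if j = p then cu C (U - {p}) else if j \<in> U then cw C j (U - {p, j}) else cv C j (U - {p}))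
      in if even (card U) \<longleftrightarrow> j = p then e U else einv D j (e (flip j U)))"

lemma representsD:
  assumes "represents p J C f" "L \<subseteq> J"
  shows "cu C L = f (evenv p L) p"
    and "j \<in> J - L \<Longrightarrow> cv C j L = f (oddv p L) j"
    and "j \<in> J - L \<Longrightarrow> cw C j L = f (oddv p (insert j L)) j"
  using assms by (simp_all add: represents_def)

lemma represents_cube_of: "represents p J (cube_of p J f) f"
  by (simp add: represents_def cube_of_def)

lemma evenv_minus: "p \<notin> L \<Longrightarrow> evenv p L - {p} = L"
  and oddv_minus: "p \<notin> L \<Longrightarrow> oddv p L - {p} = L"
  by (auto simp: evenv_def oddv_def)

lemma evenv_oddv_cases: "evenv p L = L \<and> oddv p L = insert p L \<or> evenv p L = insert p L \<and> oddv p L = L"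
  by (simp add: evenv_def oddv_def)

lemma even_evenv: "finite L \<Longrightarrow> p \<notin> L \<Longrightarrow> even (card (evenv p L))"
  and odd_oddv: "finite L \<Longrightarrow> p \<notin> L \<Longrightarrow> odd (card (oddv p L))"
  by (simp_all add: evenv_def oddv_def)

lemma flip_p_evenv: "p \<notin> L \<Longrightarrow> flip p (evenv p L) = oddv p L"
  by (auto simp: evenv_def oddv_def flip_def)

lemma flip_evenv: "\<lbrakk>finite L; j \<notin> L; j \<noteq> p\<rbrakk> \<Longrightarrow> flip j (evenv p L) = oddv p (insert j L)"
  and flip_oddv: "\<lbrakk>finite L; j \<notin> L; j \<noteq> p\<rbrakk> \<Longrightarrow> flip j (oddv p L) = evenv p (insert j L)"
  by (auto simp: evenv_def oddv_def flip_def)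

lemma even_vertex: "finite U \<Longrightarrow> even (card U) \<Longrightarrow> U = evenv p (U - {p})"
  and odd_vertex: "finite U \<Longrightarrow> odd (card U) \<Longrightarrow> U = oddv p (U - {p})"
  by (cases "p \<in> U"; auto simp: evenv_def oddv_def card_Diff_singleton_if card_gt_0_iff)+

context cube_structure
begin

lemma evenv_subset: "L \<subseteq> J \<Longrightarrow> evenv p L \<subseteq> insert p J"
  and oddv_subset: "L \<subseteq> J \<Longrightarrow> oddv p L \<subseteq> insert p J"
  by (auto simp: evenv_def oddv_def)

lemma represents_label:
  assumes "finite J" "p \<notin> J"
  shows "represents p J C (label D p C)"
  unfolding represents_def
proof (intro allI impI conjI ballI)
  fix L assume L: "L \<subseteq> J"
  then have fin: "finite L" and p: "p \<notin> L"
    using assms finite_subset by auto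
  show "cu C L = label D p C (evenv p L) p"
    using even_evenv[OF fin p] by (simp add: label_def evenv_minus[OF p])
  fix j assume j: "j \<in> J - L"
  then have jp: "j \<noteq> p" "j \<notin> L" using assms by auto
  have "j \<notin> oddv p L"
    using jp by (auto simp: oddv_def)
  then show "cv C j L = label D p C (oddv p L) j"
    using odd_oddv[OF fin p] jp by (simp add: label_def oddv_minus[OF p])
  have "j \<in> oddv p (insert j L)" "odd (card (oddv p (insert j L)))"
    "oddv p (insert j L) - {p, j} = L"
    using jp p fin odd_oddv[of "insert j L" p] by (auto simp: oddv_def)
  then show "cw C j L = label D p C (oddv p (insert j L)) j"
    using jp by (simp add: label_def)
qed

lemma reversible_label:
  assumes X: "insert p J \<subseteq> {1..k}" "p \<notin> J" and C: "cube_typed D p J C"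
  shows "reversible D (insert p J) (label D p C)"
proof -
  have fin: "finite U" if "U \<subseteq> insert p J" for U
    using that X finite_subset by (meson finite_atLeastAtMost)
  have ty: "L \<subseteq> J \<Longrightarrow> cu C L \<in> EdgeS D p"
    "\<lbrakk>L \<subseteq> J; i \<in> J - L\<rbrakk> \<Longrightarrow> cv C i L \<in> EdgeS D i \<and> cw C i L \<in> EdgeS D i" for i L
    using C unfolding cube_typed_def by meson+
  define e where "e U j = (if j = p then cu C (U - {p})
     else if j \<in> U then cw C j (U - {p, j}) else cv C j (U - {p}))" for U j
  have e: "e U j \<in> EdgeS D j" if "U \<subseteq> insert p J" "j \<in> insert p J" for U j
  proof -
    have "U - {p} \<subseteq> J" "U - {p, j} \<subseteq> J" using that by auto
    then show ?thesis
      using ty that X unfolding e_def by auto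
  qed
  have lab: "label D p C U j = (if even (card U) \<longleftrightarrow> j = p then e U j else bar j (e (flip j U) j))" for U j
    by (simp add: label_def e_def)
  show ?thesis
    unfolding reversible_def
  proof (intro allI impI ballI conjI)
    fix U j assume U: "U \<subseteq> insert p J" and j: "j \<in> insert p J"
    have k: "j \<in> {1..k}" using j X by auto
    note es = e[OF U j] e[OF flip_subset[OF U j] j]
    show "label D p C U j \<in> EdgeS D j"
      using es bar_in[OF k] by (simp add: lab)
    show "label D p C (flip j U) j = bar j (label D p C U j)"
      using es bar_bar[OF k] even_card_flip[OF fin[OF U], of j] by (simp add: lab)
  qed
qed

lemma typed_cube_of:
  assumes "reversible D (insert p J) f"
  shows "cube_typed D p J (cube_of p J f)"
  using assms evenv_subset[of _ J p] oddv_subset[of _ J p]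
  unfolding cube_typed_def cube_of_def reversible_def
  by (auto simp: insert_subset)

lemma typed_cube_eqI:
  assumes "cube_typed D p J A" "cube_typed D p J B"
    and "\<And>L. L \<subseteq> J \<Longrightarrow> cu A L = cu B L"
    and "\<And>L j. \<lbrakk>L \<subseteq> J; j \<in> J - L\<rbrakk> \<Longrightarrow> cv A j L = cv B j L \<and> cw A j L = cw B j L"
  shows "A = B"
proof (rule cube.equality)
  show "cu A = cu B"
    using assms unfolding cube_typed_def by (intro ext) metis
  show "cv A = cv B" "cw A = cw B"
    using assms unfolding cube_typed_def by (intro ext; metis)+
qed simp

lemma represents_eqI:
  assumes "cube_typed D p J A" "cube_typed D p J B"
    and "represents p J A f" "represents p J B g"
    and "\<And>U i. U \<subseteq> insert p J \<Longrightarrow> i \<in> insert p J \<Longrightarrow> f U i = g U i"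
  shows "A = B"
proof (rule typed_cube_eqI[OF assms(1,2)])
  show "cu A L = cu B L" if "L \<subseteq> J" for L
    using assms(3-5) that evenv_subset[OF that] by (simp add: represents_def)
  show "cv A j L = cv B j L \<and> cw A j L = cw B j L" if L: "L \<subseteq> J" "j \<in> J - L" for L j
  proof -
    have "insert j L \<subseteq> J" using L by auto
    then show ?thesis
      using assms(3-5) L oddv_subset[of L J p] oddv_subset[of "insert j L" J p]
      by (simp add: represents_def)
  qed
qed

text \<open>
  Every edge joins an even and an odd vertex, so a pointed cube records each edge exactly once.
\<close>

lemma represents_determines:
  assumes X: "insert p J \<subseteq> {1..k}" "p \<notin> J" and rev: "reversible D (insert p J) f" "reversible D (insert p J) g"
    and rep: "represents p J C f" "represents p J C g"
    and U: "U \<subseteq> insert p J" and i: "i \<in> insert p J"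
  shows "f U i = g U i"
proof -
  have fin: "finite W" if "W \<subseteq> insert p J" for W
    using that X finite_subset by (meson finite_atLeastAtMost)
  have main: "f W i = g W i" if W: "W \<subseteq> insert p J" "even (card W) \<longleftrightarrow> i = p" for W
  proof (cases "i = p")
    case True
    have "W - {p} \<subseteq> J" using W by auto
    moreover have W': "W = evenv p (W - {p})"
      using even_vertex fin W True by blast
    ultimately show ?thesis
      using representsD(1)[OF rep(1), of "W - {p}"] representsD(1)[OF rep(2), of "W - {p}"] True
      by (simp flip: W')
  next
    case False
    then have W': "W = oddv p (W - {p})"
      using odd_vertex fin W by blast
    show ?thesis
    proof (cases "i \<in> W")
      case True
      have "insert i (W - {p, i}) = W - {p}"
        using True False by auto
      moreover have "W - {p, i} \<subseteq> J" "i \<in> J - (W - {p, i})"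
        using W i False by auto
      ultimately show ?thesis
        using representsD(3)[OF rep(1), of "W - {p, i}" i] representsD(3)[OF rep(2), of "W - {p, i}" i]
        by (simp flip: W')
    next
      case nin: False
      have "W - {p} \<subseteq> J" "i \<in> J - (W - {p})"
        using W i False nin by auto
      then show ?thesis
        using representsD(2)[OF rep(1), of "W - {p}" i] representsD(2)[OF rep(2), of "W - {p}" i]
        by (simp flip: W')
    qed
  qed
  show ?thesis
  proof (cases "even (card U) \<longleftrightarrow> i = p")
    case True
    then show ?thesis using main U by blast
  next
    case False
    have fl: "flip i U \<subseteq> insert p J" using flip_subset[OF U i] .
    have "f (flip i U) i = g (flip i U) i"
      using main[OF fl] False even_card_flip[OF fin[OF U]] by blast
    moreover have "f U i = bar i (f (flip i U) i)" "g U i = bar i (g (flip i U) i)"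
      using rev fl i unfolding reversible_def by (metis flip_flip)+
    ultimately show ?thesis by simp
  qed
qed

text \<open>
  The relations (a), (b), (c) of a pointed cube are the boundary words of all faces, each read from
  one corner.  Faces in directions \<open>p\<close> and \<open>j\<close> are covered by (a), read from the even vertex over \<open>L\<close>.
  The two faces in directions \<open>i\<close> and \<open>j\<close> over \<open>L\<close> are covered by (b) and (c); which of the two
  contains \<open>p\<close> depends on the parity of \<open>|L|\<close>.
\<close>

lemma cube_relations_iff:
  assumes X: "insert p J \<subseteq> {1..k}" "p \<notin> J" and rev: "reversible D (insert p J) f"
    and rep: "represents p J C f"
  shows "cube_relations D p J C \<longleftrightarrow> labelling D (insert p J) f"
proof -
  have finJ: "finite J"
    using X finite_subset by (meson finite_atLeastAtMost insert_subset)
  have fl: "f (flip i U) i = bar i (f U i)" if "U \<subseteq> insert p J" "i \<in> insert p J" for U i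
    using rev that by (auto simp: reversible_def)
  have fl': "f U i = bar i (f (flip i U) i)" if "U \<subseteq> insert p J" "i \<in> insert p J" for U i
    using fl[OF flip_subset[OF that] that(2)] by simp
  have L: "finite L" "p \<notin> L" "oddv p L \<subseteq> insert p J" "evenv p L \<subseteq> insert p J" if "L \<subseteq> J" for L
    using that finJ X finite_subset evenv_subset oddv_subset by auto
  have pj: "(cu C L, cv C j L, cu C (L \<union> {j}), cw C j L) \<in> Rel D p j
      \<longleftrightarrow> square_at D f (evenv p L) p j" if "L \<subseteq> J" "j \<in> J - L" for L j
  proof -
    have j: "j \<notin> L" "j \<noteq> p" "insert j L \<subseteq> J" using that X by auto
    then show ?thesis
      using rep that L[OF that(1)]
      by (simp add: square_at_def represents_def flip_p_evenv flip_evenv flip_oddv)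
  qed
  have vij: "(bar i (cv C i L), cv C j L, bar i (cw C i (L \<union> {j})), cw C j (L \<union> {i})) \<in> Rel D i j
      \<longleftrightarrow> square_at D f (flip i (oddv p L)) i j"
    and wij: "(cw C i L, bar j (cw C j L), cv C i (L \<union> {j}), bar j (cv C j (L \<union> {i}))) \<in> Rel D i j
      \<longleftrightarrow> square_at D f (flip i (evenv p L)) i j"
    if "L \<subseteq> J" "i \<in> J - L" "j \<in> J - L" "i \<noteq> j" for L i j
  proof -
    have ij: "i \<notin> L" "i \<noteq> p" "j \<notin> L" "j \<noteq> p" "insert i L \<subseteq> J" "insert j L \<subseteq> J"
      "insert i (insert j L) \<subseteq> J" "i \<in> insert p J" "j \<in> insert p J" "i \<noteq> j" "j \<noteq> i"
      using that X by auto
    note Ls = L[OF that(1)] L[OF ij(5)] L[OF ij(6)] L[OF ij(7)]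
    have c: "cv C i L = f (oddv p L) i" "cv C j L = f (oddv p L) j"
      "cw C i L = f (oddv p (insert i L)) i" "cw C j L = f (oddv p (insert j L)) j"
      "cv C i (L \<union> {j}) = f (oddv p (insert j L)) i" "cv C j (L \<union> {i}) = f (oddv p (insert i L)) j"
      "cw C i (L \<union> {j}) = f (oddv p (insert i (insert j L))) i"
      "cw C j (L \<union> {i}) = f (oddv p (insert i (insert j L))) j"
      using rep that ij by (simp_all add: represents_def insert_commute)
    have "f (flip i (oddv p L)) i = bar i (cv C i L)"
      using fl Ls ij c by simp
    moreover have "f (flip j (oddv p L)) i = bar i (cw C i (L \<union> {j}))"
      using fl'[of "evenv p (insert j L)" i] Ls ij c by (simp add: flip_oddv flip_evenv)
    moreover have "f (flip j (flip i (oddv p L))) j = cw C j (L \<union> {i})"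
      using Ls ij c by (simp add: flip_oddv flip_evenv insert_commute)
    ultimately show "(bar i (cv C i L), cv C j L, bar i (cw C i (L \<union> {j})), cw C j (L \<union> {i})) \<in> Rel D i j
      \<longleftrightarrow> square_at D f (flip i (oddv p L)) i j"
      using c by (simp add: square_at_def)
    have "f (flip i (evenv p L)) i = cw C i L" "f (flip j (evenv p L)) i = cv C i (L \<union> {j})"
      using Ls ij c by (simp_all add: flip_evenv)
    moreover have "f (evenv p L) j = bar j (cw C j L)"
      using fl'[of "evenv p L" j] Ls ij c by (simp add: flip_evenv)
    moreover have "f (flip j (flip i (evenv p L))) j = bar j (cv C j (L \<union> {i}))"
      using fl[of "oddv p (insert i L)" j] Ls ij c by (simp add: flip_evenv)
    ultimately show "(cw C i L, bar j (cw C j L), cv C i (L \<union> {j}), bar j (cv C j (L \<union> {i}))) \<in> Rel D i j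
      \<longleftrightarrow> square_at D f (flip i (evenv p L)) i j"
      by (simp add: square_at_def)
  qed
  show ?thesis
  proof
    assume lab: "labelling D (insert p J) f"
    note sq = labellingD(3)[OF lab]
    show "cube_relations D p J C"
      unfolding cube_relations_def
    proof (intro allI impI conjI ballI)
      fix L i j assume "L \<subseteq> J \<and> card L < card J" "i \<in> J - L" "j \<in> J - L" "i \<noteq> j"
      then have ij: "L \<subseteq> J" "i \<in> J - L" "j \<in> J - L" "i \<noteq> j" by auto
      have "flip i (oddv p L) \<subseteq> insert p J" "flip i (evenv p L) \<subseteq> insert p J"
        using flip_subset[OF L(3)[OF ij(1)], of i] flip_subset[OF L(4)[OF ij(1)], of i] ij by simp_all
      then show "(bar i (cv C i L), cv C j L, bar i (cw C i (L \<union> {j})), cw C j (L \<union> {i})) \<in> Rel D i j"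
        "(cw C i L, bar j (cw C j L), cv C i (L \<union> {j}), bar j (cv C j (L \<union> {i}))) \<in> Rel D i j"
        using vij[OF ij] wij[OF ij] sq ij by auto
    next
      fix L j assume "L \<subseteq> J \<and> card L < card J" and j: "j \<in> J - L"
      then have "L \<subseteq> J" by simp
      then show "(cu C L, cv C j L, cu C (L \<union> {j}), cw C j L) \<in> Rel D p j"
        using pj[of L j] j sq[of "evenv p L" p j] L[of L] X by auto
    qed
  next
    assume rel: "cube_relations D p J C"
    have less: "card L < card J" if "L \<subseteq> J" "j \<in> J - L" for L j
      using that finJ by (intro psubset_card_mono) auto
    have sq_p: "square_at D f U p j" if U: "U \<subseteq> insert p J" and j: "j \<in> J" for U j
    proof -
      let ?L = "U - {p, j}"
      have L': "?L \<subseteq> J" "j \<in> J - ?L" using that by auto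
      have "evenv p ?L - {p, j} = U - {p, j}"
        by (auto simp: evenv_def)
      moreover have "square_at D f (evenv p ?L) p j"
        using pj[OF L'] rel less[OF L'] L' unfolding cube_relations_def by blast
      ultimately show ?thesis
        using square_at_same_face[OF rev X(1) U _ _ _ L(4)[OF L'(1)]] j X by auto
    qed
    have sq_ij: "square_at D f U i j" if U: "U \<subseteq> insert p J" and ij: "i \<in> J" "j \<in> J" "i \<noteq> j" for U i j
    proof -
      let ?L = "U - {p, i, j}"
      have L': "?L \<subseteq> J" "i \<in> J - ?L" "j \<in> J - ?L" using that by auto
      have sub: "flip i (oddv p ?L) \<subseteq> insert p J" "flip i (evenv p ?L) \<subseteq> insert p J"
        using flip_subset[OF L(3)[OF L'(1)], of i] flip_subset[OF L(4)[OF L'(1)], of i] ij by simp_all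
      have sq: "square_at D f (flip i (oddv p ?L)) i j" "square_at D f (flip i (evenv p ?L)) i j"
        using vij[OF L' ij(3)] wij[OF L' ij(3)] rel less[OF L'(1,2)] L' ij(3)
        unfolding cube_relations_def by blast+
      have "p \<noteq> i" "p \<noteq> j" using ij X by auto
      then have "U - {i, j} = ?L \<or> U - {i, j} = insert p ?L"
        by blast
      then have "U - {i, j} = oddv p ?L \<or> U - {i, j} = evenv p ?L"
        using evenv_oddv_cases[of p ?L] by metis
      moreover have "flip i W - {i, j} = W" if "W = U - {i, j}" for W
        unfolding that by (auto simp: flip_def)
      ultimately have "flip i (oddv p ?L) - {i, j} = U - {i, j} \<or> flip i (evenv p ?L) - {i, j} = U - {i, j}"
        by metis
      then show ?thesis
        using square_at_same_face[OF rev X(1) U _ _ ij(3) sub(1)]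
          square_at_same_face[OF rev X(1) U _ _ ij(3) sub(2)] sq ij by blast
    qed
    show "labelling D (insert p J) f"
      unfolding labelling_def
    proof (intro conjI allI impI ballI rev)
      fix U i j assume U: "U \<subseteq> insert p J" and ij: "i \<in> insert p J" "j \<in> insert p J" "i \<noteq> j"
      consider "i = p" "j \<in> J" | "j = p" "i \<in> J" | "i \<in> J" "j \<in> J"
        using ij by auto
      then show "square_at D f U i j"
      proof cases
        case 2
        then show ?thesis
          using square_at_flip(3)[OF rev X(1) U _ _ _ sq_p[OF U 2(2)]] X(2) by auto
      qed (use sq_p sq_ij U ij in auto)
    qed
  qed
qed

lemma label_of_cube_of:
  assumes X: "insert p J \<subseteq> {1..k}" "p \<notin> J" and f: "reversible D (insert p J) f"
    and U: "U \<subseteq> insert p J" "i \<in> insert p J"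
  shows "label D p (cube_of p J f) U i = f U i"
proof (rule represents_determines[OF X _ f _ represents_cube_of U])
  have "finite J"
    using X finite_subset by (meson finite_atLeastAtMost insert_subset)
  then show "represents p J (cube_of p J f) (label D p (cube_of p J f))"
    using represents_label X(2) by blast
  show "reversible D (insert p J) (label D p (cube_of p J f))"
    using reversible_label[OF X typed_cube_of[OF f]] .
qed

section \<open>Cubes are determined by stars\<close>

text \<open>
  For \<open>k \<ge> 3\<close> this is C3; for \<open>k = 2\<close> a cube is a single relator.
\<close>

lemma box_exists_unique:
  assumes X: "X \<subseteq> {1..k}" "card X \<ge> 2" and p: "p \<in> X"
    and corner: "cube_corner D p (X - {p}) u v u' w"
  shows "\<exists>!C. is_box D p (X - {p}) u v u' w C"
proof (cases "k \<ge> 3")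
  case True
  have "finite X" using X(1) finite_subset by blast
  then have card: "card X \<in> {2..k}" "card (X - {p}) = card X - 1"
    using X p card_mono[OF _ X(1)] by auto
  have "p \<in> {1..k}" "X - {p} \<subseteq> {1..k} - {p}"
    using X(1) p by auto
  then show ?thesis
    using C3[OF True, unfolded C3_def, rule_format, OF _ card(1) conjI[OF _ card(2)] corner] by blast
next
  case False
  have "finite X" using X(1) finite_subset by blast
  then have "card (X - {p}) = 1"
    using False X p card_mono[OF _ X(1)] by auto
  then obtain j where J: "X - {p} = {j}"
    by (auto simp: card_1_singleton_iff)
  then have "j \<in> X - {p}" by simp
  then have k: "p \<in> {1..k}" "j \<in> {1..k}" "p \<noteq> j"
    using X(1) p by blast+
  have rel: "(u, v j, u' j, w j) \<in> Rel D p j" "u \<in> EdgeS D p"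
    using corner by (simp_all add: cube_corner_def J)
  note ty = Rel_subset[OF k rel(1)]
  have subs: "L \<subseteq> {j} \<longleftrightarrow> L = {} \<or> L = {j}" for L by auto
  define C where "C = \<lparr>cu = \<lambda>L. if L = {} then u else if L = {j} then u' j else undefined,
     cv = \<lambda>i L. if i = j \<and> L = {} then v j else undefined,
     cw = \<lambda>i L. if i = j \<and> L = {} then w j else undefined\<rparr>"
  have "is_box D p {j} u v u' w C"
    using ty rel by (auto simp: is_box_def cube_typed_def cube_relations_def C_def subs)
  moreover have "C1 = C2" if "is_box D p {j} u v u' w C1" "is_box D p {j} u v u' w C2" for C1 C2
  proof (rule typed_cube_eqI[of p "{j}"])
    show "cu C1 L = cu C2 L" if "L \<subseteq> {j}" for L
      using that \<open>is_box D p {j} u v u' w C1\<close> \<open>is_box D p {j} u v u' w C2\<close>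
      by (auto simp: subs is_box_def)
    show "cv C1 i L = cv C2 i L \<and> cw C1 i L = cw C2 i L" if "L \<subseteq> {j}" "i \<in> {j} - L" for i L
      using that \<open>is_box D p {j} u v u' w C1\<close> \<open>is_box D p {j} u v u' w C2\<close>
      by (auto simp: subs is_box_def)
  qed (use that in \<open>auto simp: is_box_def\<close>)
  ultimately show ?thesis
    unfolding J by blast
qed

lemma is_box_cube_of:
  assumes X: "insert p J \<subseteq> {1..k}" "p \<notin> J" and f: "labelling D (insert p J) f"
  shows "is_box D p J (f {} p) (f {p}) (\<lambda>j. f {p, j} p) (\<lambda>j. f {j} j) (cube_of p J f)"
    and "cube_corner D p J (f {} p) (f {p}) (\<lambda>j. f {p, j} p) (\<lambda>j. f {j} j)"
proof -
  have rev: "reversible D (insert p J) f"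
    using f by (simp add: labelling_def)
  have "cube_relations D p J (cube_of p J f)"
    using cube_relations_iff[OF X rev represents_cube_of] f by simp
  then show "is_box D p J (f {} p) (f {p}) (\<lambda>j. f {p, j} p) (\<lambda>j. f {j} j) (cube_of p J f)"
    using typed_cube_of[OF rev] by (auto simp: is_box_def cube_of_def evenv_def oddv_def)
  have "(f {} p, f {p} j, f {p, j} p, f {j} j) \<in> Rel D p j" if "j \<in> J" for j
  proof -
    have "square_at D f {} p j"
      using labellingD(3)[OF f, of "{}" p j] that X by auto
    moreover have "p \<noteq> j" using that X by auto
    ultimately show ?thesis
      by (simp add: square_at_def flip_notin insert_commute)
  qed
  then show "cube_corner D p J (f {} p) (f {p}) (\<lambda>j. f {p, j} p) (\<lambda>j. f {j} j)"
    using labellingD(1)[OF f, of "{}" p] by (simp add: cube_corner_def)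
qed

text \<open>
  By C2 the letters leaving the base vertex in directions \<open>i\<close> and \<open>j\<close> determine the face that they
  span, hence the corner from which the cube is built.
\<close>

lemma star_determines_base:
  assumes X: "X \<subseteq> {1..k}" and f: "labelling D X f" and g: "labelling D X g"
    and star: "\<And>i. i \<in> X \<Longrightarrow> f {} i = g {} i" and U: "U \<subseteq> X" "i \<in> X"
  shows "f U i = g U i"
proof (cases "card X \<ge> 2")
  case True
  let ?J = "X - {i}"
  have X': "insert i ?J \<subseteq> {1..k}" "i \<notin> ?J" "insert i ?J = X"
    using X U by auto
  have bf: "labelling D (insert i ?J) f" and bg: "labelling D (insert i ?J) g"
    using f g X'(3) by simp_all
  note cf = is_box_cube_of[OF X'(1,2) bf]
  note cg = is_box_cube_of[OF X'(1,2) bg]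
  have same: "f {i} j = g {i} j" "f {i, j} i = g {i, j} i" "f {j} j = g {j} j" if j: "j \<in> ?J" for j
  proof -
    have "f {j} j = bar j (f {} j)" "g {j} j = bar j (g {} j)"
      using labellingD(2)[OF f, of "{}" j] labellingD(2)[OF g, of "{}" j] j by (simp_all add: flip_notin)
    then show w: "f {j} j = g {j} j"
      using star j by simp
    have sq: "(f {} i, f {i} j, f {i, j} i, f {j} j) \<in> Rel D i j"
      "(g {} i, g {i} j, g {i, j} i, g {j} j) \<in> Rel D i j"
      using cf(2) cg(2) j unfolding cube_corner_def by blast+
    have k: "i \<in> {1..k}" "j \<in> {1..k}" "i \<noteq> j"
      using j X U by auto
    show "f {i} j = g {i} j" "f {i, j} i = g {i, j} i"
      using square_unique[OF k sq(2)] sq(1) star[OF U(2)] w by auto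
  qed
  have "is_box D i ?J (f {} i) (f {i}) (\<lambda>j. f {i, j} i) (\<lambda>j. f {j} j) (cube_of i ?J g)"
    using cg(1) same star[OF U(2)] by (simp add: is_box_def)
  then have "cube_of i ?J f = cube_of i ?J g"
    using box_exists_unique[OF X True U(2) cf(2)] cf(1) by blast
  then show ?thesis
    using label_of_cube_of[OF X'(1,2)] bf bg U X'(3) unfolding labelling_def by metis
next
  case False
  have "finite X" using X finite_subset by blast
  then have "card X = 1"
    using False U(2) card_gt_0_iff[of X] by auto
  then have "X = {i}"
    using U(2) by (auto simp: card_1_singleton_iff)
  then have "U = {} \<or> U = flip i {}"
    using U by (auto simp: flip_def)
  then show ?thesis
    using star[OF U(2)] labellingD(2)[OF f _ U(2), of "{}"] labellingD(2)[OF g _ U(2), of "{}"] by auto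
qed

lemma star_determines:
  assumes X: "X \<subseteq> {1..k}" and f: "labelling D X f" and g: "labelling D X g"
    and T: "T \<subseteq> X" and star: "\<And>i. i \<in> X \<Longrightarrow> f T i = g T i" and U: "U \<subseteq> X" "i \<in> X"
  shows "f U i = g U i"
proof -
  have W: "sym_diff U T \<subseteq> X" using U T by auto
  have "sym_diff (sym_diff U T) T = U" by auto
  then show ?thesis
    using star_determines_base[OF X labelling_translate[OF f T] labelling_translate[OF g T] _ W U(2)] star
    by simp
qed

text \<open>
  Squares through the given letters of one direction \<open>p\<close> and each other direction exist by C2 and
  form the corner of a cube based at \<open>{}\<close>, which is then reflected to be based at \<open>T\<close>.
\<close>

lemma star_extends:
  assumes T: "T \<subseteq> {1..k}" and s: "\<And>i. i \<in> {1..k} \<Longrightarrow> s i \<in> EdgeS D i"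
  shows "\<exists>f. labelling D {1..k} f \<and> (\<forall>i\<in>{1..k}. f T i = s i)"
proof -
  have card: "card {1..k} \<ge> 2" using k2 by simp
  then obtain p where p: "p \<in> {1..k}" by fastforce
  let ?J = "{1..k} - {p}"
  have X: "insert p ?J \<subseteq> {1..k}" "p \<notin> ?J" "insert p ?J = {1..k}" "p \<in> {1..k}"
    using p by auto
  have fin: "finite ?J" by simp
  have "\<forall>j\<in>?J. \<exists>b a'. (s p, b, a', bar j (s j)) \<in> Rel D p j"
    using square_exists[OF p] bar_in s p by auto
  then obtain v u' where vu: "\<forall>j\<in>?J. (s p, v j, u' j, bar j (s j)) \<in> Rel D p j"
    by metis
  then have corner: "cube_corner D p ?J (s p) v u' (\<lambda>j. bar j (s j))"
    using s X(4) by (simp add: cube_corner_def)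
  then obtain C where C: "is_box D p ?J (s p) v u' (\<lambda>j. bar j (s j)) C"
    using box_exists_unique[OF subset_refl card p corner] by blast
  let ?g = "label D p C"
  note rep = represents_label[OF fin X(2), of C]
  have rev: "reversible D (insert p ?J) ?g"
    using reversible_label[OF X(1,2)] C by (simp add: is_box_def)
  have g: "labelling D {1..k} ?g"
    using cube_relations_iff[OF X(1,2) rev rep] C X(3) by (simp add: is_box_def)
  have "?g {} i = s i" if "i \<in> {1..k}" for i
  proof (cases "i = p")
    case True
    then show ?thesis
      using rep C by (simp add: represents_def is_box_def evenv_def)
  next
    case False
    then have "cw C i {} = ?g (oddv p {i}) i"
      using rep that unfolding represents_def by blast
    then have "?g {i} i = bar i (s i)"
      using C that False by (simp add: is_box_def oddv_def)
    moreover have "?g {i} i = bar i (?g {} i)"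
      using labellingD(2)[OF g, of "{}" i] that by (simp add: flip_notin)
    ultimately show ?thesis
      using bar_eq_iff[OF that] labellingD(1)[OF g, of "{}" i] s that by auto
  qed
  then have "\<forall>i\<in>{1..k}. ?g (sym_diff T T) i = s i" by simp
  then show ?thesis
    using labelling_translate[OF g T] by blast
qed

section \<open>Adjacency of labelled cubes\<close>

text \<open>
  The face of \<open>f\<close> opposite to the base in direction \<open>i\<close> coincides with the base face of \<open>g\<close>, and no edge
  of direction \<open>i\<close> is continued by its reverse: \<open>f (insert i U) i\<close> leads back into \<open>f\<close>, whereas
  \<open>g U i\<close> leads into \<open>g\<close>.
\<close>

definition adjacent :: "nat set \<Rightarrow> nat \<Rightarrow> (nat set \<Rightarrow> nat \<Rightarrow> 'a) \<Rightarrow> (nat set \<Rightarrow> nat \<Rightarrow> 'a) \<Rightarrow> bool" where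
  "adjacent X i f g \<longleftrightarrow> (\<forall>U\<subseteq>X - {i}. \<forall>j\<in>X. f (insert i U) j = g U j \<longleftrightarrow> j \<noteq> i)"

text \<open>
  Agreement off \<open>i\<close> spreads over the common face, which is determined by its star at one vertex.  If
  the letters of direction \<open>i\<close> agreed at another vertex, then \<open>f\<close> would be the mirror image of \<open>g\<close> there,
  hence everywhere.
\<close>

lemma adjacent_at_vertex:
  assumes X: "X \<subseteq> {1..k}" and f: "labelling D X f" and g: "labelling D X g"
    and i: "i \<in> X" and W: "W \<subseteq> X - {i}"
  shows "adjacent X i f g \<longleftrightarrow> (\<forall>j\<in>X. f (insert i W) j = g W j \<longleftrightarrow> j \<noteq> i)"
proof
  assume "adjacent X i f g"
  then show "\<forall>j\<in>X. f (insert i W) j = g W j \<longleftrightarrow> j \<noteq> i"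
    using W by (simp add: adjacent_def)
next
  assume star: "\<forall>j\<in>X. f (insert i W) j = g W j \<longleftrightarrow> j \<noteq> i"
  have f': "labelling D (X - {i}) (\<lambda>U. f (U \<union> {i}))" and g': "labelling D (X - {i}) (\<lambda>U. g (U \<union> {}))"
    using labelling_face[OF f, of "X - {i}" "{i}"] labelling_face[OF g, of "X - {i}" "{}"] i by auto
  have face: "f (insert i U) j = g U j" if "U \<subseteq> X - {i}" "j \<in> X - {i}" for U j
    using star_determines[OF _ f' g' W _ that] star X by auto
  have "f (insert i U) i \<noteq> g U i" if U: "U \<subseteq> X - {i}" for U
  proof
    assume eq: "f (insert i U) i = g U i"
    have "f (insert i U) j = g U j" if "j \<in> X" for j
      using face[OF U] eq that by (cases "j = i") auto
    moreover have "insert i U \<subseteq> X" "sym_diff (insert i U) {i} = U" "sym_diff (insert i W) {i} = W"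
      "insert i W \<subseteq> X"
      using U W i by auto
    moreover have "{i} \<subseteq> X" using i by simp
    ultimately have "f (insert i W) i = g W i"
      using star_determines[OF X f labelling_translate[OF g, of "{i}"], of "insert i U" "insert i W" i] i
      by simp
    then show False using star i by blast
  qed
  with face show "adjacent X i f g"
    by (auto simp: adjacent_def)
qed

text \<open>
  The vertex common to the four cubes of the block is \<open>{i, j}\<close> in \<open>f\<close>, \<open>{j}\<close> in \<open>g\<close>, \<open>{}\<close> in \<open>h\<close> and
  \<open>{i}\<close> in the cube that is sought.  There it has to agree with \<open>h\<close> off \<open>i\<close> and with \<open>f\<close> off \<open>j\<close>; these
  requirements are compatible, because both \<open>f\<close> and \<open>h\<close> agree with \<open>g\<close> in the remaining
  directions.
\<close>

lemma adjacent_swap: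
  assumes X: "X = {1..k}" and f: "labelling D X f" and g: "labelling D X g" and h: "labelling D X h"
    and ij: "i \<in> X" "j \<in> X" "i \<noteq> j" and adj: "adjacent X i f g" "adjacent X j g h"
  shows "\<exists>g'. labelling D X g' \<and> adjacent X j f g' \<and> adjacent X i g' h"
proof -
  define s where "s = (h {}) (i := f {i, j} i)"
  have "s l \<in> EdgeS D l" if "l \<in> X" for l
    using labellingD(1)[OF h, of "{}" l] labellingD(1)[OF f, of "{i, j}" i] that ij by (simp add: s_def)
  then obtain g' where g': "labelling D X g'" and star: "\<forall>l\<in>X. g' {i} l = s l"
    using star_extends[of "{i}" s] ij X by auto
  have fg: "f {i, j} l = g {j} l \<longleftrightarrow> l \<noteq> i" if "l \<in> X" for l
    using adj(1) that ij unfolding adjacent_def by blast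
  have gh: "g {j} l = h {} l \<longleftrightarrow> l \<noteq> j" if "l \<in> X" for l
    using adj(2) that ij unfolding adjacent_def by blast
  have "adjacent X i g' h"
  proof (subst adjacent_at_vertex[OF _ g' h ij(1), of "{}"])
    show "\<forall>l\<in>X. g' {i} l = h {} l \<longleftrightarrow> l \<noteq> i"
      using star fg gh ij unfolding s_def by (metis fun_upd_apply)
  qed (use X in auto)
  moreover have "adjacent X j f g'"
  proof (subst adjacent_at_vertex[OF _ f g' ij(2), of "{i}"])
    show "\<forall>l\<in>X. f {j, i} l = g' {i} l \<longleftrightarrow> l \<noteq> j"
      using star fg gh ij(3) unfolding s_def insert_commute[of j i] by (metis fun_upd_apply)
  qed (use X ij in auto)
  ultimately show ?thesis
    using g' by blast
qed

lemma adjacent_unique2: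
  assumes X: "X \<subseteq> {1..k}" and lab: "labelling D X f" "labelling D X g" "labelling D X g'"
    and ij: "i \<in> X" "j \<in> X" "i \<noteq> j"
    and adj: "adjacent X i f g" "adjacent X j g h" "adjacent X i f g'" "adjacent X j g' h"
    and U: "U \<subseteq> X" "l \<in> X"
  shows "g U l = g' U l"
proof (rule star_determines[OF X lab(2,3) _ _ U])
  show "{j} \<subseteq> X" using ij by simp
  fix m assume m: "m \<in> X"
  have sub: "{j} \<subseteq> X - {i}" "{} \<subseteq> X - {j}" using ij by auto
  have fg: "f {i, j} m = a {j} m" if "adjacent X i f a" "m \<noteq> i" for a
    using that m sub(1) unfolding adjacent_def by blast
  have gh: "a {j} m = h {} m" if "adjacent X j a h" "m \<noteq> j" for a
    using that m sub(2) unfolding adjacent_def by blast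
  show "g {j} m = g' {j} m"
    using fg[OF adj(1)] fg[OF adj(3)] gh[OF adj(2)] gh[OF adj(4)] ij(3) by metis
qed

text \<open>
  All cubes share the vertex that is \<open>{i, j, l}\<close> in \<open>f\<close> and \<open>{}\<close> in \<open>d\<close>.  A letter of \<open>g\<close> at
  this vertex agrees with \<open>f\<close> unless its direction is \<open>i\<close>, and in direction \<open>i\<close> it agrees with \<open>d\<close>.
  For \<open>h\<close> the same holds with \<open>l\<close> in place of \<open>i\<close> and the ends exchanged.
\<close>

lemma adjacent_unique3:
  assumes X: "X \<subseteq> {1..k}"
    and lab: "labelling D X f" "labelling D X g" "labelling D X h" "labelling D X g'" "labelling D X h'"
    and ij: "i \<in> X" "j \<in> X" "l \<in> X" "distinct [i, j, l]"
    and adj: "adjacent X i f g" "adjacent X j g h" "adjacent X l h d"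
    and adj': "adjacent X i f g'" "adjacent X j g' h'" "adjacent X l h' d"
    and U: "U \<subseteq> X" "m \<in> X"
  shows "g U m = g' U m" "h U m = h' U m"
proof -
  have neq: "i \<noteq> j" "i \<noteq> l" "j \<noteq> l" using ij by auto
  have sub: "{j, l} \<subseteq> X - {i}" "{l} \<subseteq> X - {j}" "{} \<subseteq> X - {l}" using ij by auto
  have fg: "f {i, j, l} q = a {j, l} q" if "adjacent X i f a" "q \<in> X" "q \<noteq> i" for a q
    using that sub(1) unfolding adjacent_def by blast
  have gh: "a {j, l} q = b {l} q" if "adjacent X j a b" "q \<in> X" "q \<noteq> j" for a b q
    using that sub(2) unfolding adjacent_def by blast
  have hd: "b {l} q = d {} q" if "adjacent X l b d" "q \<in> X" "q \<noteq> l" for b q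
    using that sub(3) unfolding adjacent_def by blast
  have 1: "g {j, l} q = g' {j, l} q" if q: "q \<in> X" for q
  proof (cases "q = i")
    case True
    then show ?thesis
      using gh[OF adj(2) q] gh[OF adj'(2) q] hd[OF adj(3) q] hd[OF adj'(3) q] neq by simp
  next
    case False
    then show ?thesis
      using fg[OF adj(1) q] fg[OF adj'(1) q] by simp
  qed
  have 2: "h {l} q = h' {l} q" if q: "q \<in> X" for q
  proof (cases "q = l")
    case True
    then show ?thesis
      using gh[OF adj(2) q] gh[OF adj'(2) q] 1[OF q] neq by simp
  next
    case False
    then show ?thesis
      using hd[OF adj(3) q] hd[OF adj'(3) q] by simp
  qed
  show "g U m = g' U m"
    using star_determines[OF X lab(2,4) _ 1 U] ij by simp
  show "h U m = h' U m"
    using star_determines[OF X lab(3,5) _ 2 U] ij by simp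
qed

lemma adjacent_into:
  assumes X: "X = {1..k}" and g: "labelling D X g" and i: "i \<in> X"
  shows "\<exists>f. labelling D X f \<and> adjacent X i f g"
proof -
  obtain b where b: "b \<in> EdgeS D i" "b \<noteq> g {} i"
    using other_edge i X by blast
  define s where "s = (g {}) (i := b)"
  have "s l \<in> EdgeS D l" if "l \<in> X" for l
    using labellingD(1)[OF g, of "{}" l] b that by (simp add: s_def)
  then obtain f where f: "labelling D X f" "\<forall>l\<in>X. f {i} l = s l"
    using star_extends[of "{i}" s] i X by auto
  have "adjacent X i f g"
    by (subst adjacent_at_vertex[OF _ f(1) g i, of "{}"]) (use X f(2) b s_def in auto)
  then show ?thesis
    using f by blast
qed

section \<open>Adjacency matrices\<close>

lemma adjacent_cong:
  assumes "\<And>U j. U \<subseteq> X \<Longrightarrow> j \<in> X \<Longrightarrow> f U j = f' U j" "\<And>U j. U \<subseteq> X \<Longrightarrow> j \<in> X \<Longrightarrow> g U j = g' U j"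
    and "i \<in> X"
  shows "adjacent X i f g \<longleftrightarrow> adjacent X i f' g'"
proof -
  have "insert i U \<subseteq> X \<and> U \<subseteq> X" if "U \<subseteq> X - {i}" for U
    using that assms(3) by auto
  then show ?thesis
    unfolding adjacent_def using assms(1,2) by metis
qed

text \<open>
  The matrices compare each edge of the common face in one orientation only; this is the matching form of
  adjacency.
\<close>

lemma adjacent_half:
  assumes X: "X \<subseteq> {1..k}" and f: "reversible D X f" and g: "reversible D X g" and i: "i \<in> X"
  shows "adjacent X i f g \<longleftrightarrow> (\<forall>U\<subseteq>X - {i}. f (insert i U) i \<noteq> g U i \<and>
    (\<forall>j\<in>X - insert i U. f (insert i U) j = g U j))" (is "_ \<longleftrightarrow> ?half")
proof
  assume "adjacent X i f g"
  then have "f (insert i U) j = g U j \<longleftrightarrow> j \<noteq> i" if "U \<subseteq> X - {i}" "j \<in> X" for U j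
    using that by (simp add: adjacent_def)
  then show ?half
    using i by blast
next
  assume "?half"
  then have half: "f (insert i U) i \<noteq> g U i" "j \<in> X - insert i U \<Longrightarrow> f (insert i U) j = g U j"
    if "U \<subseteq> X - {i}" for U j
    using that by blast+
  have "f (insert i U) j = g U j" if U: "U \<subseteq> X - {i}" and j: "j \<in> X" "j \<noteq> i" for U j
  proof (cases "j \<in> U")
    case True
    let ?W = "U - {j}"
    have W: "f (insert i ?W) j = g ?W j"
      using half(2)[of ?W j] U j by blast
    have "flip j (insert i ?W) = insert i U" "flip j ?W = U" "insert i ?W \<subseteq> X" "?W \<subseteq> X"
      using True j U i by (auto simp: flip_def)
    then have "f (insert i U) j = bar j (f (insert i ?W) j)" "g U j = bar j (g ?W j)"
      using f g j(1) unfolding reversible_def by metis+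
    then show ?thesis using W by simp
  next
    case False
    then show ?thesis using half(2)[of U j] U j by blast
  qed
  then show "adjacent X i f g"
    using half(1) unfolding adjacent_def by metis
qed

text \<open>
  Letters of \<open>A\<close> are recorded at vertices of fixed parity, and gluing along direction \<open>p\<close> changes
  the parity of a vertex; so the letter of \<open>A\<close> is compared with the inverse of a letter of \<open>B\<close>.
\<close>

lemma adjacent_p_iff:
  assumes X: "insert p J \<subseteq> {1..k}" "p \<notin> J"
    and f: "reversible D (insert p J) f" and g: "reversible D (insert p J) g"
    and rep: "represents p J A f" "represents p J B g"
  shows "adjacent_p D p J A B \<longleftrightarrow> adjacent (insert p J) p f g"
proof -
  have fin: "finite J"
    using X finite_subset by (meson finite_atLeastAtMost insert_subset)
  note revf = reversibleD[OF f] and revg = reversibleD[OF g]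
  have "(cu A L \<noteq> bar p (cu B L) \<and>
      (\<forall>j\<in>J - L. if even (card L) then cv A j L = bar j (cw B j L) else cw A j L = bar j (cv B j L)))
    \<longleftrightarrow> (f (insert p L) p \<noteq> g L p \<and> (\<forall>j\<in>insert p J - insert p L. f (insert p L) j = g L j))"
    if L: "L \<subseteq> J" for L
  proof -
    let ?E = "evenv p L" and ?O = "oddv p L"
    have pL: "p \<notin> L" "finite L" using L X fin finite_subset by auto
    have sub: "?E \<subseteq> insert p J" "?O \<subseteq> insert p J" "L \<subseteq> insert p J" "insert p L \<subseteq> insert p J"
      using L evenv_subset[OF L] oddv_subset[OF L] by auto
    have kp: "p \<in> {1..k}" using X by auto
    have "cu A L = f ?E p" "cu B L = g ?E p"
      using representsD(1)[OF rep(1) L] representsD(1)[OF rep(2) L] by simp_all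
    moreover have "f (insert p L) p = bar p (f L p)" "g (insert p L) p = bar p (g L p)"
      using revf(2)[of L p] revg(2)[of L p] sub by (simp_all add: flip_notin[OF pL(1)])
    ultimately have 1: "cu A L \<noteq> bar p (cu B L) \<longleftrightarrow> f (insert p L) p \<noteq> g L p"
      using bar_eq_iff[OF kp revf(1) revg(1)] bar_bar[OF kp revg(1)] sub
      by (auto simp: evenv_def)
    have 2: "(if even (card L) then cv A j L = bar j (cw B j L) else cw A j L = bar j (cv B j L))
        \<longleftrightarrow> f (insert p L) j = g L j" if j: "j \<in> J - L" for j
    proof -
      have jX: "j \<in> insert p J" "j \<notin> L" "j \<noteq> p" and kj: "j \<in> {1..k}" using j X by auto
      have "oddv p (insert j L) = flip j ?E"
        using flip_evenv pL jX by simp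
      then have "cv A j L = f ?O j" "cv B j L = g ?O j"
        "cw A j L = bar j (f ?E j)" "cw B j L = bar j (g ?E j)"
        using representsD(2,3)[OF rep(1) L j] representsD(2,3)[OF rep(2) L j]
          revf(2)[OF sub(1) jX(1)] revg(2)[OF sub(1) jX(1)] by simp_all
      then show ?thesis
        using bar_eq_iff[OF kj revf(1) revg(1)] bar_bar[OF kj revg(1)] sub jX(1)
        by (auto simp: evenv_def oddv_def)
    qed
    have "insert p J - insert p L = J - L" using X L by auto
    then show ?thesis using 1 2 by simp
  qed
  moreover have "insert p J - {p} = J" using X by auto
  ultimately show ?thesis
    unfolding adjacent_half[OF X(1) f g insertI1] adjacent_p_def by metis
qed

lemma adjacent_other_iff:
  assumes X: "insert p J \<subseteq> {1..k}" "p \<notin> J" and i: "i \<in> J"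
    and f: "reversible D (insert p J) f" and g: "reversible D (insert p J) g"
    and rep: "represents p J A f" "represents p J B g"
  shows "adjacent_other D p J i A B \<longleftrightarrow> adjacent (insert p J) i f g"
proof -
  let ?X = "insert p J"
  have fin: "finite J"
    using X finite_subset by (meson finite_atLeastAtMost insert_subset)
  note revf = reversibleD[OF f] and revg = reversibleD[OF g]
  have kp: "p \<in> {1..k}" and ki: "i \<in> {1..k}" using X i by auto
  have ip: "i \<noteq> p" using i X by auto
  define match where "match U j \<longleftrightarrow> f (insert i U) j = g U j" for U j
  have other: "(bar p (cu B L) = cu A (L \<union> {i}) \<and>
      (\<forall>j\<in>J - (L \<union> {i}). bar j (cv B j L) = cw A j (L \<union> {i}) \<and> bar j (cw B j L) = cv A j (L \<union> {i})) \<and>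
      cv A i L \<noteq> bar i (cv B i L) \<and> cw A i L \<noteq> bar i (cw B i L))
    \<longleftrightarrow> match L p \<and> (\<forall>U\<in>{L, insert p L}. \<not> match U i \<and> (\<forall>j\<in>J - (L \<union> {i}). match U j))"
    if L: "L \<subseteq> J - {i}" for L
  proof -
    let ?E = "evenv p L" and ?O = "oddv p L"
    have LJ: "L \<subseteq> J" "insert i L \<subseteq> J" "i \<in> J - L" using L i by auto
    have pL: "p \<notin> L" "p \<notin> insert i L" "finite L" "finite (insert i L)" "i \<notin> L"
      using L X ip fin finite_subset[of L J] by auto
    have sub: "?E \<subseteq> ?X" "?O \<subseteq> ?X" "L \<subseteq> ?X" "insert p L \<subseteq> ?X"
      using LJ evenv_subset[OF LJ(1)] oddv_subset[OF LJ(1)] by auto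
    have iX: "i \<in> ?X" using i by simp
    have nin: "i \<notin> ?E" "i \<notin> ?O" using pL ip by (auto simp: evenv_def oddv_def)
    have subi: "insert i ?E \<subseteq> ?X" "insert i ?O \<subseteq> ?X" using sub iX by auto
    have Ei: "oddv p (insert i L) = insert i ?E" and Oi: "evenv p (insert i L) = insert i ?O"
      using flip_evenv[of L i p] flip_oddv[of L i p] pL ip nin by (simp_all add: flip_notin)
    have "match ?E p \<longleftrightarrow> match L p"
    proof (cases "?E = L")
      case False
      then have E: "?E = insert p L" using evenv_oddv_cases by blast
      have "f (insert i (insert p L)) p = bar p (f (insert i L) p)" "g (insert p L) p = bar p (g L p)"
        using revf(2)[of "insert i L" p] revg(2)[of L p] LJ pL by (auto simp: flip_notin insert_commute)
      then show ?thesis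
        using bar_eq_iff(1)[OF kp revf(1) revg(1), of "insert i L" L] LJ sub E
        by (auto simp: match_def)
    qed simp
    moreover have "cu B L = g ?E p" "cu A (L \<union> {i}) = bar p (f (insert i ?E) p)"
    proof -
      show "cu B L = g ?E p" using representsD(1)[OF rep(2) LJ(1)] .
      have "flip p (insert i ?E) = insert i ?O"
        using flip_p_evenv[OF pL(1)] ip by (auto simp: flip_def)
      then show "cu A (L \<union> {i}) = bar p (f (insert i ?E) p)"
        using representsD(1)[OF rep(1) LJ(2)] Oi revf(2)[OF subi(1), of p] by simp
    qed
    ultimately have 1: "bar p (cu B L) = cu A (L \<union> {i}) \<longleftrightarrow> match L p"
      using bar_eq_iff(1)[OF kp revg(1)[OF sub(1)] revf(1)[OF subi(1)]] by (auto simp: match_def)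
    have 2: "(bar j (cv B j L) = cw A j (L \<union> {i}) \<longleftrightarrow> match ?O j) \<and>
        (bar j (cw B j L) = cv A j (L \<union> {i}) \<longleftrightarrow> match ?E j)" if j: "j \<in> J - (L \<union> {i})" for j
    proof -
      have jX: "j \<in> ?X" "j \<in> J - L" "j \<in> J - insert i L" "j \<noteq> p" "j \<notin> L" "j \<notin> insert i L"
        and kj: "j \<in> {1..k}" using j X by auto
      have "oddv p (insert j L) = flip j ?E" "oddv p (insert j (insert i L)) = flip j (insert i ?O)"
        using flip_evenv pL jX Oi by (metis, metis)
      then have "cv B j L = g ?O j" "cw B j L = bar j (g ?E j)"
        "cv A j (L \<union> {i}) = f (insert i ?E) j" "cw A j (L \<union> {i}) = bar j (f (insert i ?O) j)"
        using representsD(2,3)[OF rep(2) LJ(1) jX(2)] representsD(2,3)[OF rep(1) LJ(2) jX(3)] Ei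
          revf(2)[OF subi(2) jX(1)] revg(2)[OF sub(1) jX(1)] by simp_all
      then show ?thesis
        using bar_eq_iff(1)[OF kj revg(1)[OF sub(2) jX(1)] revf(1)[OF subi(2) jX(1)]]
          bar_bar[OF kj revg(1)[OF sub(1) jX(1)]]
        by (auto simp: match_def)
    qed
    have c: "cv A i L = f ?O i" "cv B i L = g ?O i" "cw A i L = f (insert i ?E) i"
      "cw B i L = bar i (g ?E i)" "f (insert i ?O) i = bar i (f ?O i)"
      using representsD(2,3)[OF rep(2) LJ(1,3)] representsD(2,3)[OF rep(1) LJ(1,3)] Ei
        revf(2)[OF sub(2) iX] revg(2)[OF sub(1) iX] nin by (simp_all add: flip_notin)
    have 3: "cv A i L \<noteq> bar i (cv B i L) \<longleftrightarrow> \<not> match ?O i"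
      using c bar_eq_iff(2)[OF ki revf(1)[OF sub(2) iX] revg(1)[OF sub(2) iX]] by (simp add: match_def)
    have 4: "cw A i L \<noteq> bar i (cw B i L) \<longleftrightarrow> \<not> match ?E i"
      using c bar_bar[OF ki revg(1)[OF sub(1) iX]] by (simp add: match_def)
    have 5: "{L, insert p L} = {?E, ?O}"
      using evenv_oddv_cases[of p L] by auto
    show ?thesis
      unfolding 1 3 4 5 using 2 by auto
  qed
  have half: "adjacent ?X i f g \<longleftrightarrow>
      (\<forall>U\<subseteq>?X - {i}. \<not> match U i \<and> (\<forall>j\<in>?X - insert i U. match U j))"
    using adjacent_half[OF X(1) f g] i by (simp add: match_def)
  show ?thesis
  proof
    assume "adjacent_other D p J i A B"
    then have m: "match L p \<and> (\<forall>U\<in>{L, insert p L}. \<not> match U i \<and> (\<forall>j\<in>J - (L \<union> {i}). match U j))"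
      if "L \<subseteq> J - {i}" for L
      using other[OF that] that unfolding adjacent_other_def by blast
    show "adjacent ?X i f g"
      unfolding half
    proof (intro allI impI)
      fix U assume U: "U \<subseteq> ?X - {i}"
      let ?L = "U - {p}"
      have L: "?L \<subseteq> J - {i}" using U by auto
      have UL: "U \<in> {?L, insert p ?L}" by auto
      have "match U j" if "j \<in> ?X - insert i U" for j
      proof (cases "j = p")
        case True
        then have "?L = U" using that by auto
        then show ?thesis using m[OF L] True by simp
      next
        case False
        then have "j \<in> J - (?L \<union> {i})" using that by auto
        then show ?thesis using m[OF L] UL by blast
      qed
      then show "\<not> match U i \<and> (\<forall>j\<in>?X - insert i U. match U j)"
        using m[OF L] UL by blast
    qed
  next
    assume "adjacent ?X i f g"
    then have m: "\<not> match U i \<and> (\<forall>j\<in>?X - insert i U. match U j)" if "U \<subseteq> ?X - {i}" for U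
      using that half by blast
    have "match L p \<and> (\<forall>U\<in>{L, insert p L}. \<not> match U i \<and> (\<forall>j\<in>J - (L \<union> {i}). match U j))"
      if L: "L \<subseteq> J - {i}" for L
    proof -
      have "L \<subseteq> ?X - {i}" "insert p L \<subseteq> ?X - {i}" "p \<in> ?X - insert i L"
        "J - (L \<union> {i}) \<subseteq> ?X - insert i L" "J - (L \<union> {i}) \<subseteq> ?X - insert i (insert p L)"
        using L ip X(2) by auto
      then show ?thesis using m by blast
    qed
    from iffD2[OF other this] show "adjacent_other D p J i A B"
      unfolding adjacent_other_def by simp
  qed
qed

end

section \<open>The rank-k graph of a cube group\<close>

locale based_cube_structure = cube_structure +
  fixes p :: nat
  assumes p: "p \<in> {1..k}"
begin

abbreviation J where "J \<equiv> {1..k} - {p}"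
abbreviation lab where "lab \<equiv> label D p"
abbreviation S where "S \<equiv> pointed_cubes k D p"

lemma insert_J: "insert p J = {1..k}"
  and J_props: "insert p J \<subseteq> {1..k}" "p \<notin> J" "finite J"
  using p by auto

lemma pointed_cubes_iff: "C \<in> S \<longleftrightarrow> cube_typed D p J C \<and> cube_relations D p J C"
proof
  assume C: "cube_typed D p J C \<and> cube_relations D p J C"
  have "(cu C {}, cv C j {}, cu C {j}, cw C j {}) \<in> Rel D p j" if "j \<in> J" for j
  proof -
    have "{} \<subseteq> J \<and> card {} < card J"
      using that by (auto simp: card_gt_0_iff)
    then have "\<forall>j\<in>J - {}. (cu C {}, cv C j {}, cu C ({} \<union> {j}), cw C j {}) \<in> Rel D p j"
      using C unfolding cube_relations_def by blast
    then show ?thesis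
      using that by simp
  qed
  moreover have "cu C {} \<in> EdgeS D p"
    using C unfolding cube_typed_def by (metis empty_subsetI)
  ultimately have "cube_corner D p J (cu C {}) (\<lambda>j. cv C j {}) (\<lambda>j. cu C {j}) (\<lambda>j. cw C j {})"
    by (simp add: cube_corner_def)
  moreover have "is_box D p J (cu C {}) (\<lambda>j. cv C j {}) (\<lambda>j. cu C {j}) (\<lambda>j. cw C j {}) C"
    using C by (simp add: is_box_def)
  ultimately show "C \<in> S"
    unfolding pointed_cubes_def
    by (intro CollectI exI[of _ "cu C {}"] exI[of _ "\<lambda>j. cv C j {}"] exI[of _ "\<lambda>j. cu C {j}"]
        exI[of _ "\<lambda>j. cw C j {}"] conjI)
qed (auto simp: pointed_cubes_def is_box_def)

lemma label_represents: "represents p J C (lab C)"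
  using represents_label J_props by blast

lemma labelling_label: "C \<in> S \<Longrightarrow> labelling D {1..k} (lab C)"
  using cube_relations_iff[OF J_props(1,2) reversible_label[OF J_props(1,2)] label_represents, of C]
  unfolding insert_J pointed_cubes_iff by blast

lemma label_inject:
  assumes "A \<in> S" "B \<in> S" "\<And>U i. U \<subseteq> {1..k} \<Longrightarrow> i \<in> {1..k} \<Longrightarrow> lab A U i = lab B U i"
  shows "A = B"
  using represents_eqI[OF _ _ label_represents label_represents, of A B] assms
  unfolding insert_J pointed_cubes_iff by blast

lemma label_surjective:
  assumes f: "labelling D {1..k} f"
  shows "\<exists>C\<in>S. \<forall>U\<subseteq>{1..k}. \<forall>i\<in>{1..k}. lab C U i = f U i"
proof -
  have rev: "reversible D (insert p J) f"
    using f unfolding labelling_def insert_J by blast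
  have "cube_of p J f \<in> S"
    using typed_cube_of[OF rev] cube_relations_iff[OF J_props(1,2) rev represents_cube_of] f
    unfolding pointed_cubes_iff insert_J by blast
  then show ?thesis
    using label_of_cube_of[OF J_props(1,2) rev] unfolding insert_J by blast
qed

lemma finite_pointed_cubes: "finite S"
proof -
  \<comment> \<open>A cube is determined by its star at the base vertex, and there are finitely many stars.\<close>
  let ?star = "\<lambda>C. restrict (lab C {}) {1..k}"
  have "inj_on ?star S"
  proof (rule inj_onI)
    fix A B assume AB: "A \<in> S" "B \<in> S" "?star A = ?star B"
    have eq: "lab A {} i = lab B {} i" if "i \<in> {1..k}" for i
      using fun_cong[OF AB(3), of i] that by (simp add: restrict_def)
    then show "A = B"
      by (intro label_inject AB(1,2)
          star_determines_base[OF subset_refl labelling_label[OF AB(1)] labelling_label[OF AB(2)] eq])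
  qed
  moreover have "?star ` S \<subseteq> PiE {1..k} (EdgeS D)"
    using labellingD(1)[OF labelling_label] by fastforce
  moreover have "finite (PiE {1..k} (EdgeS D))"
    using finite_edges by (intro finite_PiE) auto
  ultimately show ?thesis
    by (meson finite_imageD finite_subset)
qed

lemma coloured_edges_iff:
  "(i, A, B) \<in> coloured_edges S k (adj_matrix k D p) \<longleftrightarrow>
     i \<in> {1..k} \<and> A \<in> S \<and> B \<in> S \<and> adjacent {1..k} i (lab A) (lab B)"
proof -
  have "adj_matrix k D p i A B = 1 \<longleftrightarrow> adjacent {1..k} i (lab A) (lab B)"
    if "i \<in> {1..k}" "A \<in> S" "B \<in> S"
  proof -
    have rev: "reversible D (insert p J) (lab A)" "reversible D (insert p J) (lab B)"
      using labelling_label that unfolding labelling_def insert_J by blast+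
    show ?thesis
    proof (cases "i = p")
      case True
      then show ?thesis
        using adjacent_p_iff[OF J_props(1,2) rev label_represents label_represents]
        unfolding adj_matrix_def insert_J by simp
    next
      case False
      then have "i \<in> J" using that(1) by simp
      from adjacent_other_iff[OF J_props(1,2) this rev label_represents label_represents] False
      show ?thesis
        unfolding adj_matrix_def insert_J by simp
    qed
  qed
  then show ?thesis
    by (auto simp: coloured_edges_def)
qed

sublocale square_graph S k "adj_matrix k D p"
proof
  show "finite S" by (rule finite_pointed_cubes)
next
  fix i A B j C
  assume "(i, A, B) \<in> coloured_edges S k (adj_matrix k D p)"
    "(j, B, C) \<in> coloured_edges S k (adj_matrix k D p)" and ij: "i \<noteq> j"
  then have e: "i \<in> {1..k}" "j \<in> {1..k}" "A \<in> S" "B \<in> S" "C \<in> S"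
    "adjacent {1..k} i (lab A) (lab B)" "adjacent {1..k} j (lab B) (lab C)"
    by (simp_all only: coloured_edges_iff)
  obtain g where g: "labelling D {1..k} g" "adjacent {1..k} j (lab A) g" "adjacent {1..k} i g (lab C)"
    using adjacent_swap[OF refl labelling_label[OF e(3)] labelling_label[OF e(4)] labelling_label[OF e(5)]
        e(1,2) ij e(6,7)] by blast
  obtain B' where B': "B' \<in> S" "\<forall>U\<subseteq>{1..k}. \<forall>i\<in>{1..k}. lab B' U i = g U i"
    using label_surjective[OF g(1)] by blast
  have "adjacent {1..k} j (lab A) (lab B')" "adjacent {1..k} i (lab B') (lab C)"
    using g B' e adjacent_cong[of "{1..k}" "lab A" "lab A" "lab B'" g j]
      adjacent_cong[of "{1..k}" "lab B'" g "lab C" "lab C" i] by auto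
  then show "\<exists>B'. (j, A, B') \<in> coloured_edges S k (adj_matrix k D p) \<and>
      (i, B', C) \<in> coloured_edges S k (adj_matrix k D p)"
    using B' e coloured_edges_iff by blast
next
  fix i A B j C B'
  assume "(i, A, B) \<in> coloured_edges S k (adj_matrix k D p)"
    "(j, B, C) \<in> coloured_edges S k (adj_matrix k D p)"
    "(i, A, B') \<in> coloured_edges S k (adj_matrix k D p)"
    "(j, B', C) \<in> coloured_edges S k (adj_matrix k D p)" and ij: "i \<noteq> j"
  then have e: "i \<in> {1..k}" "j \<in> {1..k}" "A \<in> S" "B \<in> S" "B' \<in> S"
    and adj: "adjacent {1..k} i (lab A) (lab B)" "adjacent {1..k} j (lab B) (lab C)"
    "adjacent {1..k} i (lab A) (lab B')" "adjacent {1..k} j (lab B') (lab C)"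
    by (simp_all only: coloured_edges_iff)
  show "B = B'"
    by (intro label_inject e adjacent_unique2[OF subset_refl labelling_label[OF e(3)]
          labelling_label[OF e(4)] labelling_label[OF e(5)] e(1,2) ij adj])
next
  fix i A B j C l X B' C'
  assume "(i, A, B) \<in> coloured_edges S k (adj_matrix k D p)"
    "(j, B, C) \<in> coloured_edges S k (adj_matrix k D p)"
    "(l, C, X) \<in> coloured_edges S k (adj_matrix k D p)"
    "(i, A, B') \<in> coloured_edges S k (adj_matrix k D p)"
    "(j, B', C') \<in> coloured_edges S k (adj_matrix k D p)"
    "(l, C', X) \<in> coloured_edges S k (adj_matrix k D p)" and d: "distinct [i, j, l]"
  then have e: "i \<in> {1..k}" "j \<in> {1..k}" "l \<in> {1..k}" "A \<in> S" "B \<in> S" "C \<in> S" "B' \<in> S" "C' \<in> S"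
    and adj: "adjacent {1..k} i (lab A) (lab B)" "adjacent {1..k} j (lab B) (lab C)"
    "adjacent {1..k} l (lab C) (lab X)" "adjacent {1..k} i (lab A) (lab B')"
    "adjacent {1..k} j (lab B') (lab C')" "adjacent {1..k} l (lab C') (lab X)"
    by (simp_all only: coloured_edges_iff)
  note u = adjacent_unique3[OF subset_refl labelling_label[OF e(4)] labelling_label[OF e(5)]
      labelling_label[OF e(6)] labelling_label[OF e(7)] labelling_label[OF e(8)] e(1-3) d adj]
  show "B = B' \<and> C = C'"
    by (intro conjI label_inject e u)
next
  fix B i
  assume Bi: "B \<in> S" "i \<in> {1..k}"
  then obtain f where f: "labelling D {1..k} f" "adjacent {1..k} i f (lab B)"
    using adjacent_into[OF refl labelling_label[OF Bi(1)] Bi(2)] by blast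
  obtain A where A: "A \<in> S" "\<forall>U\<subseteq>{1..k}. \<forall>i\<in>{1..k}. lab A U i = f U i"
    using label_surjective[OF f(1)] by blast
  have "adjacent {1..k} i (lab A) (lab B)"
    using f A Bi adjacent_cong[of "{1..k}" "lab A" f "lab B" "lab B" i] by auto
  then show "\<exists>A. (i, A, B) \<in> coloured_edges S k (adj_matrix k D p)"
    using A Bi coloured_edges_iff by blast
qed

end

theorem theorem3p3:
  fixes k p :: nat
    and D :: "'a adjacency"
    and \<Gamma> :: "(nat \<times> 'a) list set monoid"
  assumes "k \<ge> 2"
    and "k_cube_group k D \<Gamma>"
    and "p \<in> {1..k}"
  shows "rank_k_graph (cube_graph k D p) k class_degree
    \<and> row_finite (cube_graph k D p) k class_degree
    \<and> no_sources (cube_graph k D p) k class_degree"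
proof -
  interpret based_cube_structure k D p
    using assms by unfold_locales (auto simp: k_cube_group_def)
  show ?thesis
    unfolding cube_graph_def
    using rank_k_graph_quot row_finite_quot no_sources_quot by blast
qed

end
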